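(* Let $\Phi=(\phi_n)$ be a Riesz basis for $\mathcal H$, let $\Psi=(\psi_n)$ be a sequence in $\mathcal H$ and let $m=(m_n)$ be a complex scalar sequence, with $m_n\ne 0$, $\phi_n\neq 0$, $\psi_n\neq 0$ for all $n$. (a) Let $m$ be $SN$. (a1) If $\Psi$ is non-Bessel for $\mathcal H$, then both $M_{m,\Phi,\Psi}$ and $M_{m,\Psi,\Phi}$ are not well defined on $\mathcal H$. (a2) If $\Psi$ is Bessel for $\mathcal H$, then $M_{m,\Phi,\Psi}$ (resp. $M_{m,\Psi,\Phi}$) is invertible on $\mathcal H$ if and only if $\Psi$ is a Riesz basis for $\mathcal H$. In the cases of invertibility, $M_{m,\Phi,\Psi}^{-1}=M_{(1/m_n),\widetilde\Psi,\widetilde\Phi}$. (b) Let $m$ be non-$NBB$ and $m\in\ell^\infty$. (b1) If $\Psi$ is $NBA$ and non-Bessel for $\mathcal H$, then $M_{m,\Phi,\Psi}$ (resp. $M_{m,\Psi,\Phi}$) can either be well defined on $\mathcal H$ or not, but can never be invertible on $\mathcal H$. (b2) If $\Psi$ is non-$NBA$, non-$NBB$ and non-Bessel for $\mathcal H$, then $M_{m,\Phi,\Psi}$ (resp. $M_{m,\Psi,\Phi}$) can either be well defined on $\mathcal H$ or not, but can never be invertible on $\mathcal H$. (b3) If $\Psi$ is non-$NBA$, $NBB$ and non-Bessel for $\mathcal H$, then for $M_{m,\Phi,\Psi}$ and $M_{m,\Psi,\Phi}$ all three feasible combinations are possible: they can be invertible on $\mathcal H$, can be well defined and non-invertible on $\mathcal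 H$, or can be not well defined. (b4) If $\Psi$ is Bessel for $\mathcal H$, then $M_{m,\Phi,\Psi}$ (resp. $M_{m,\Psi,\Phi}$) is well defined on $\mathcal H$, but not invertible on $\mathcal H$. (c) Let $m$ be $NBB$ and $m\notin\ell^\infty$. (c1) If $\Psi$ is non-Bessel for $\mathcal H$ or $NBB$, then both $M_{m,\Phi,\Psi}$ and $M_{m,\Psi,\Phi}$ are not well defined. (c2) If $\Psi$ is non-$NBB$ and Bessel for $\mathcal H$, but not a frame for $\mathcal H$, then for $M_{m,\Phi,\Psi}$ and $M_{m,\Psi,\Phi}$ all three feasible combinations (invertible; well defined and non-invertible; not well defined) are possible. (c3) If $\Psi$ is a non-$NBB$ frame for $\mathcal H$, then $M_{m,\Phi,\Psi}$ (resp. $M_{m,\Psi,\Phi}$) can either be well defined on $\mathcal H$ or not, but can never be invertible on $\mathcal H$. (d) Let $m$ be non-$NBB$ and $m\notin\ell^\infty$. (d1) If $\Psi$ is $NBB$, then both $M_{m,\Phi,\Psi}$ and $M_{m,\Psi,\Phi}$ are not well defined. (d2) If $\Psi$ is non-$NBB$, non-$NBA$ and non-Bessel for $\mathcal H$, then for $M_{m,\Phi,\Psi}$ (resp. $M_{m,\Psi,\Phi}$) all three feasible combinations (invertible; well defined and non-invertible; not well defined) are possible. (d3) If $\Psi$ is non-$NBB$ and $NBA$, then $M_{m,\Phi,\Psi}$ (resp. $M_{m,\Psi,\Phi}$) can either be well defined on $\mathcal H$ or not, but can never be invertible on $\mathcal H$. Here "can be"/"is possible" means that there exist a Riesz basis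 $\Phi$, a sequence $\Psi$ and a symbol $m$ satisfying the hypotheses of the respective item for which the stated behaviour occurs, and "can never be" means that it occurs for no such $\Phi,\Psi,m$.
   Context: $\mathcal H$ is a separable infinite-dimensional complex Hilbert space, inner product linear in the first argument; all sequences are indexed by $\mathbb N$. For sequences $\Phi=(\phi_n),\Psi=(\psi_n)$ in $\mathcal H$ and a complex sequence $m=(m_n)$, the multiplier is $M_{m,\Phi,\Psi}f=\sum_n m_n\langle f,\psi_n\rangle\phi_n$; it is well defined on $\mathcal H$ if the series converges for every $f\in\mathcal H$. It is invertible on $\mathcal H$ if it is well defined on $\mathcal H$ and has a bounded two-sided inverse $\mathcal H\to\mathcal H$. $\Phi$ is Bessel for $\mathcal H$ with bound $B>0$ if $\sum|\langle h,\phi_n\rangle|^2\le B\|h\|^2$ for all $h\in\mathcal H$; non-Bessel means not Bessel for any bound. A frame for $\mathcal H$ with bounds $A,B$ is a Bessel sequence with bound $B$ such that for some $A>0$, $A\|h\|^2\le\sum|\langle h,\phi_n\rangle|^2$ for all $h\in\mathcal H$. A Riesz basis for $\mathcal H$ is a complete sequence in $\mathcal H$ (closed linear span equal to $\mathcal H$) with $A\sum|c_n|^2\le\|\sum c_n\phi_n\|^2\le B\sum|c_n|^2$ for all $(c_n)\in\ell^2$, for some $0<A\le B<\infty$. For a frame $\Phi$, $S_\Phi h=\sum\langle h,\phi_n\rangle\phi_n$ is the (invertible) frame operator and $\widetilde\Phi=(S_\Phi^{-1}\phi_n)$ is the canonical dual. A sequence in $\mathcal H$ is $NBA$ (norm-bounded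 above) if $\sup_n\|\phi_n\|<\infty$, and $NBB$ (norm-bounded below) if $\inf_n\|\phi_n\|>0$; a scalar sequence $m$ is $NBB$ if $\inf_n|m_n|>0$ and $SN$ (semi-normalized) if $0<a\le|m_n|\le b<\infty$ for all $n$ for some constants $a,b$. "Non-" denotes negation. *)

theory Defs
  imports "HOL-Analysis.Analysis"
begin

(* Complex Hilbert spaces, with cinner linear in its first argument.  The superclass real_inner
   provides norm, metric and topology; the last axiom ties them to cinner, see cinner_self. *)
class complex_hilbert = real_inner + complete_space +
  fixes scaleC :: "complex \<Rightarrow> 'a \<Rightarrow> 'a" (infixr "*\<^sub>C" 75)
    and cinner :: "'a \<Rightarrow> 'a \<Rightarrow> complex"
  assumes scaleC_add_right: "a *\<^sub>C (x + y) = a *\<^sub>C x + a *\<^sub>C y"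
    and scaleC_add_left: "(a + b) *\<^sub>C x = a *\<^sub>C x + b *\<^sub>C x"
    and scaleC_scaleC: "a *\<^sub>C (b *\<^sub>C x) = (a * b) *\<^sub>C x"
    and scaleC_of_real: "complex_of_real r *\<^sub>C x = r *\<^sub>R x"
    and cinner_commute: "cinner x y = cnj (cinner y x)"
    and cinner_add_left: "cinner (x + y) z = cinner x z + cinner y z"
    and cinner_scaleC_left: "cinner (a *\<^sub>C x) y = a * cinner x y"
    and inner_eq_Re_cinner: "inner x y = Re (cinner x y)"

lemma cinner_self: "cinner x x = complex_of_real ((norm x)\<^sup>2)"
proof -
  have "Im (cinner x x) = - Im (cinner x x)"
    by (subst cinner_commute) simp
  then have "Im (cinner x x) = 0" by simp
  then show ?thesis
    by (simp add: complex_eq_iff power2_norm_eq_inner inner_eq_Re_cinner)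
qed

interpretation complex_vector: vector_space "scaleC :: complex \<Rightarrow> 'a \<Rightarrow> 'a::complex_hilbert"
proof
  fix x :: 'a
  show "1 *\<^sub>C x = x" using scaleC_of_real[of 1 x] by simp
qed (simp_all add: scaleC_add_right scaleC_add_left scaleC_scaleC)

definition cspan :: "'a::complex_hilbert set \<Rightarrow> 'a set" where
  "cspan S = module.span scaleC S"

definition bounded_clinear :: "('a::complex_hilbert \<Rightarrow> 'a) \<Rightarrow> bool" where
  "bounded_clinear T \<longleftrightarrow> bounded_linear T \<and> (\<forall>c x. T (c *\<^sub>C x) = c *\<^sub>C T x)"

subsection \<open>Bessel sequences, frames, Riesz bases\<close>

definition bessel :: "(nat \<Rightarrow> 'a::complex_hilbert) \<Rightarrow> bool" where
  "bessel \<Phi> \<longleftrightarrow> (\<exists>B>0. \<forall>h. summable (\<lambda>n. (cmod (cinner h (\<Phi> n)))\<^sup>2) \<and>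
     (\<Sum>n. (cmod (cinner h (\<Phi> n)))\<^sup>2) \<le> B * (norm h)\<^sup>2)"

definition frame :: "(nat \<Rightarrow> 'a::complex_hilbert) \<Rightarrow> bool" where
  "frame \<Phi> \<longleftrightarrow> bessel \<Phi> \<and>
     (\<exists>A>0. \<forall>h. A * (norm h)\<^sup>2 \<le> (\<Sum>n. (cmod (cinner h (\<Phi> n)))\<^sup>2))"

definition riesz_basis :: "(nat \<Rightarrow> 'a::complex_hilbert) \<Rightarrow> bool" where
  "riesz_basis \<Phi> \<longleftrightarrow> closure (cspan (range \<Phi>)) = UNIV \<and>
     (\<exists>A B. 0 < A \<and> A \<le> B \<and>
       (\<forall>c :: nat \<Rightarrow> complex. summable (\<lambda>n. (cmod (c n))\<^sup>2) \<longrightarrow>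
          summable (\<lambda>n. c n *\<^sub>C \<Phi> n) \<and>
          A * (\<Sum>n. (cmod (c n))\<^sup>2) \<le> (norm (\<Sum>n. c n *\<^sub>C \<Phi> n))\<^sup>2 \<and>
          (norm (\<Sum>n. c n *\<^sub>C \<Phi> n))\<^sup>2 \<le> B * (\<Sum>n. (cmod (c n))\<^sup>2)))"

(* Meaningful when \<Phi> is a frame; then the series converges and the frame operator is bijective. *)
definition frame_operator :: "(nat \<Rightarrow> 'a::complex_hilbert) \<Rightarrow> 'a \<Rightarrow> 'a" where
  "frame_operator \<Phi> h = (\<Sum>n. cinner h (\<Phi> n) *\<^sub>C \<Phi> n)"

definition canonical_dual :: "(nat \<Rightarrow> 'a::complex_hilbert) \<Rightarrow> nat \<Rightarrow> 'a" where
  "canonical_dual \<Phi> n = inv (frame_operator \<Phi>) (\<Phi> n)"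

subsection \<open>Norm conditions, for vector and for scalar sequences\<close>

definition NBA :: "(nat \<Rightarrow> 'b::real_normed_vector) \<Rightarrow> bool" where
  "NBA x \<longleftrightarrow> bdd_above (range (\<lambda>n. norm (x n)))"

definition NBB :: "(nat \<Rightarrow> 'b::real_normed_vector) \<Rightarrow> bool" where
  "NBB x \<longleftrightarrow> (INF n. norm (x n)) > 0"

definition SN :: "(nat \<Rightarrow> complex) \<Rightarrow> bool" where
  "SN m \<longleftrightarrow> (\<exists>a b. 0 < a \<and> (\<forall>n. a \<le> cmod (m n) \<and> cmod (m n) \<le> b))"

definition ell_infty :: "(nat \<Rightarrow> complex) set" where
  "ell_infty = {m. bounded (range m)}"

subsection \<open>Multipliers\<close>

definition multiplier_well_defined ::
    "(nat \<Rightarrow> complex) \<Rightarrow> (nat \<Rightarrow> 'a::complex_hilbert) \<Rightarrow> (nat \<Rightarrow> 'a) \<Rightarrow> bool" where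
  "multiplier_well_defined m \<Phi> \<Psi> \<longleftrightarrow> (\<forall>f. summable (\<lambda>n. (m n * cinner f (\<Psi> n)) *\<^sub>C \<Phi> n))"

(* Only meaningful at f where the series converges. *)
definition multiplier ::
    "(nat \<Rightarrow> complex) \<Rightarrow> (nat \<Rightarrow> 'a::complex_hilbert) \<Rightarrow> (nat \<Rightarrow> 'a) \<Rightarrow> 'a \<Rightarrow> 'a" where
  "multiplier m \<Phi> \<Psi> f = (\<Sum>n. (m n * cinner f (\<Psi> n)) *\<^sub>C \<Phi> n)"

definition multiplier_invertible ::
    "(nat \<Rightarrow> complex) \<Rightarrow> (nat \<Rightarrow> 'a::complex_hilbert) \<Rightarrow> (nat \<Rightarrow> 'a) \<Rightarrow> bool" where
  "multiplier_invertible m \<Phi> \<Psi> \<longleftrightarrow> multiplier_well_defined m \<Phi> \<Psi> \<and>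
     (\<exists>G. bounded_clinear G \<and> (\<forall>f. G (multiplier m \<Phi> \<Psi> f) = f) \<and> (\<forall>f. multiplier m \<Phi> \<Psi> (G f) = f))"

definition admissible ::
    "(nat \<Rightarrow> 'a::complex_hilbert) \<Rightarrow> (nat \<Rightarrow> 'a) \<Rightarrow> (nat \<Rightarrow> complex) \<Rightarrow> bool" where
  "admissible \<Phi> \<Psi> m \<longleftrightarrow> riesz_basis \<Phi> \<and> (\<forall>n. m n \<noteq> 0 \<and> \<Phi> n \<noteq> 0 \<and> \<Psi> n \<noteq> 0)"

end

theory Submission
  imports Defs
begin

text \<open>
  If \<open>\<Phi>\<close> is a Riesz basis, its synthesis and analysis operators are bijective, so everything about
  both multipliers is decided by the sequence \<open>m \<Psi>\<close> alone: each of \<open>M(m,\<Phi>,\<Psi>)\<close> and \<open>M(m,\<Psi>,\<Phi>)\<close> is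
  well defined iff \<open>m \<Psi>\<close> is Bessel (by uniform boundedness) and invertible iff \<open>m \<Psi>\<close> is a Riesz basis.
  The impossibility statements follow since Bessel sequences are norm-bounded above and Riesz bases
  also norm-bounded below, except for (c3), where the dual of \<open>m \<Psi>\<close> would violate the lower frame
  bound of \<open>\<Psi>\<close>. The examples weight an orthonormal basis, or \<open>e\<^sub>0, e\<^sub>0, e\<^sub>1, e\<^sub>1, \<dots>\<close>,
  or the constant sequence \<open>e\<^sub>0\<close>, by integer powers of \<open>n + 1\<close>.
\<close>

section \<open>The complex inner product\<close>

text \<open>Synthesis and analysis relate the space to square-summable sequences. A fixed
  orthonormal basis encodes these sequences as vectors, so that all operators act on the one space;
  separability and infinite dimension provide such a basis indexed by the naturals.

  Moving \<open>m n\<close> into the second slot of \<open>cinner\<close> conjugates it, so one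
  multiplier involves cnj(m) \<Psi> and the other m \<Psi>. The criteria coincide because the Bessel
  and Riesz basis properties ignore unimodular factors, and because a synthesis operator is
  invertible exactly when its adjoint, the analysis operator, is.

  Norms alone cannot settle (c3): an unbounded m can exactly compensate decaying norms of \<Psi>,
  leaving m \<Psi> with norms bounded on both sides.

  A weighted orthonormal basis is Bessel as soon as its norms are bounded, and if it is a frame, its
  norms are bounded below. Examples of that shape therefore fail in (b1) and (c3), where repeated or
  doubled basis vectors take over.\<close>

instance complex_hilbert \<subseteq> banach ..

text \<open>The norm comes from the real inner product, so complex homogeneity has to be recovered
  from \<open>cinner_self\<close>.\<close>

lemma norm_scaleC: "norm (a *\<^sub>C x) = cmod a * norm x" for x :: "'a::complex_hilbert"
proof -
  have "cinner (a *\<^sub>C x) (a *\<^sub>C x) = a * cnj (a * cinner x x)"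
    using cinner_commute[of x "a *\<^sub>C x"] by (simp only: cinner_scaleC_left)
  also have "\<dots> = (a * cnj a) * complex_of_real ((norm x)\<^sup>2)"
    by (simp add: cinner_self)
  also have "\<dots> = complex_of_real ((cmod a)\<^sup>2 * (norm x)\<^sup>2)"
    by (simp only: complex_norm_square[symmetric] of_real_mult)
  finally have "(norm (a *\<^sub>C x))\<^sup>2 = (cmod a)\<^sup>2 * (norm x)\<^sup>2"
    unfolding cinner_self of_real_eq_iff .
  then show ?thesis
    by (simp add: power_mult_distrib[symmetric])
qed

lemma cinner_scaleC_right: "cinner x (a *\<^sub>C y) = cnj a * cinner x y"
  by (metis cinner_commute cinner_scaleC_left complex_cnj_mult)

lemma cinner_add_right: "cinner x (y + z) = cinner x y + cinner x z"
  by (metis cinner_add_left cinner_commute complex_cnj_add)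

text \<open>Rotating x by a unimodular u makes the complex inner product real and nonnegative, where
  the real Cauchy-Schwarz inequality applies.\<close>

lemma norm_cinner_le: "cmod (cinner x y) \<le> norm x * norm y" for x :: "'a::complex_hilbert"
proof -
  obtain u where u: "cmod u = 1" "u * cinner x y = complex_of_real (cmod (cinner x y))"
  proof (cases "cinner x y = 0")
    case False
    then show ?thesis
      by (intro that[of "cnj (cinner x y) / complex_of_real (cmod (cinner x y))"])
        (simp_all add: norm_divide complex_norm_square[symmetric] mult.commute[of "cnj _"] power2_eq_square)
  qed (auto intro: that[of 1])
  have "cmod (cinner x y) = inner (u *\<^sub>C x) y"
    by (simp add: inner_eq_Re_cinner cinner_scaleC_left u)
  also have "\<dots> \<le> norm x * norm y"
    using Cauchy_Schwarz_ineq2[of "u *\<^sub>C x" y] by (simp add: norm_scaleC u)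
  finally show ?thesis .
qed

lemma norm_cinner_commute: "cmod (cinner x y) = cmod (cinner y x)"
  by (subst cinner_commute) simp

text \<open>Over the reals the conjugation in the second argument is invisible, so the sesquilinear
  form inherits all facts on sums, differences and limits of bounded bilinear maps.\<close>

interpretation cinner: bounded_bilinear "cinner :: 'a::complex_hilbert \<Rightarrow> 'a \<Rightarrow> complex"
proof
  show "\<exists>K. \<forall>(a::'a) b. cmod (cinner a b) \<le> norm a * norm b * K"
    by (rule exI[of _ 1]) (simp add: norm_cinner_le)
qed (simp_all add: cinner_add_left cinner_add_right cinner_scaleC_left cinner_scaleC_right
  scaleR_conv_of_real flip: scaleC_of_real)

interpretation scaleC: bounded_bilinear "scaleC :: complex \<Rightarrow> 'a \<Rightarrow> 'a::complex_hilbert"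
proof
  show "\<exists>K. \<forall>a (b::'a). norm (a *\<^sub>C b) \<le> norm a * norm b * K"
    by (rule exI[of _ 1]) (simp add: norm_scaleC)
qed (simp_all add: scaleC_add_left scaleC_add_right scaleC_scaleC
  scaleR_conv_of_real mult.commute flip: scaleC_of_real)

lemma cinner_self_eq_0: "cinner x x = 0 \<longleftrightarrow> x = 0" for x :: "'a::complex_hilbert"
  by (simp add: cinner_self)

lemma cinner_sums_left: "f sums x \<Longrightarrow> (\<lambda>n. cinner (f n) y) sums cinner x y"
  by (rule bounded_linear.sums[OF cinner.bounded_linear_left])

lemma scaleC_sums: "f sums x \<Longrightarrow> (\<lambda>n. a *\<^sub>C f n) sums (a *\<^sub>C x)"
  for x :: "'a::complex_hilbert"
  by (rule bounded_linear.sums[OF scaleC.bounded_linear_right])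

section \<open>Bessel sequences and uniform boundedness\<close>

text \<open>Applied to the partial sums of a multiplier series, this turns convergence at every
  vector into one bound for all partial sums.\<close>

lemma banach_steinhaus:
  fixes T :: "'i::countable \<Rightarrow> 'a::{real_normed_vector,complete_space} \<Rightarrow> 'b::real_normed_vector"
  assumes lin: "\<And>i. bounded_linear (T i)"
    and bdd: "\<And>x. bounded (range (\<lambda>i. T i x))"
  obtains K where "K > 0" "\<And>i x. norm (T i x) \<le> K * norm x"
proof -
  define E where "E k = {x. \<forall>i. norm (T i x) \<le> real k}" for k
  have "E k = (\<Inter>i. {x. norm (T i x) \<le> real k})" for k
    by (auto simp: E_def)
  then have clo: "closed (E k)" for k
    by (auto intro!: closed_INT closed_Collect_le continuous_intros
        linear_continuous_on[OF lin])
  have "(\<Union>k. E k) = UNIV"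
  proof (intro equalityI subsetI UNIV_I)
    fix x
    obtain B where "\<And>i. norm (T i x) \<le> B"
      using bdd[of x] by (auto simp: bounded_iff)
    moreover obtain k where "B \<le> real k" using real_arch_simple by blast
    ultimately show "x \<in> (\<Union>k. E k)" unfolding E_def by (blast intro: order_trans)
  qed
  have "\<exists>k. interior (E k) \<noteq> {}"
  proof (rule ccontr)
    assume "\<nexists>k. interior (E k) \<noteq> {}"
    \<comment> \<open>Baire: if no closed set \<open>E k\<close> had interior points, neither would
      their countable union, which is the whole space.\<close>
    then have "Met_TC.mtopology interior_of \<Union>(range E) = {}"
      by (intro Met_TC.metric_Baire_category_alt)
        (auto simp: clo complete_UNIV)
    then show False using \<open>(\<Union>k. E k) = UNIV\<close> by simp
  qed
  then obtain k a r where r: "r > 0" "ball a r \<subseteq> E k"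
    by (metis equals0I mem_interior)
  \<comment> \<open>For y of norm r/2 in the direction of x, T y = T (a + y) - T a has norm at most
    2k. Rescaling to x multiplies by 2 |x| / r, and k + 1 in place of k keeps K positive.\<close>
  define K where "K = 4 * (real k + 1) / r"
  show thesis
  proof (rule that[of K])
    show "K > 0" using r by (simp add: K_def)
    fix i x
    interpret bounded_linear "T i" by (rule lin)
    show "norm (T i x) \<le> K * norm x"
    proof (cases "x = 0")
      case False
      define y where "y = (r / (2 * norm x)) *\<^sub>R x"
      have "norm y < r" using False r by (simp add: y_def)
      then have "a + y \<in> E k" "a \<in> E k" using r by (auto simp: dist_norm)
      then have *: "norm (T i (a + y)) \<le> real k" "norm (T i a) \<le> real k" by (auto simp: E_def)
      have "norm (T i y) \<le> norm (T i (a + y)) + norm (T i a)"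
        using norm_triangle_ineq4[of "T i (a + y)" "T i a"] by (simp add: add)
      also have "\<dots> \<le> 2 * (real k + 1)" using * by simp
      finally have "r / (2 * norm x) * norm (T i x) \<le> 2 * (real k + 1)"
        using r by (simp add: y_def scaleR)
      then show ?thesis using r False by (simp add: K_def field_simps)
    qed (simp add: zero)
  qed
qed

lemma summable_of_sum_le:
  fixes f :: "nat \<Rightarrow> real"
  assumes "\<And>n. 0 \<le> f n" "\<And>N. sum f {..<N} \<le> B"
  shows "summable f" "suminf f \<le> B"
proof -
  show "summable f"
    by (rule bounded_imp_summable[of f B]) (simp_all only: assms flip: lessThan_Suc_atMost)
  then show "suminf f \<le> B" using assms(2) by (rule suminf_le_const)
qed

lemma besselI:
  fixes \<omega> :: "nat \<Rightarrow> 'a::complex_hilbert"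
  assumes "\<And>h N. (\<Sum>n<N. (cmod (cinner h (\<omega> n)))\<^sup>2) \<le> B * (norm h)\<^sup>2"
  shows "bessel \<omega>"
proof -
  \<comment> \<open>\<open>bessel\<close> asks for a positive constant, while B is arbitrary
    here.\<close>
  have bound: "(\<Sum>n<N. (cmod (cinner h (\<omega> n)))\<^sup>2) \<le> max B 1 * (norm h)\<^sup>2" for h N
    by (rule order_trans[OF assms mult_right_mono]) auto
  show ?thesis
    unfolding bessel_def using summable_of_sum_le[OF _ bound]
    by (intro exI[of _ "max B 1"]) auto
qed

text \<open>Test y, the finite combination, against itself: Cauchy-Schwarz bounds |y|^4 by the
  coefficient sum times B |y|^2, and |y|^2 cancels. Arbitrary finite index sets are allowed because
  the Cauchy criterion uses blocks \<open>m..<n\<close> and the norm bound uses singletons.\<close>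

lemma bessel_imp_synthesis_bound:
  fixes \<omega> :: "nat \<Rightarrow> 'a::complex_hilbert"
  assumes "bessel \<omega>"
  obtains B where "B > 0"
    "\<And>c F. finite F \<Longrightarrow> (norm (\<Sum>n\<in>F. c n *\<^sub>C \<omega> n))\<^sup>2 \<le> B * (\<Sum>n\<in>F. (cmod (c n))\<^sup>2)"
proof -
  obtain B where B: "B > 0" "\<And>h. summable (\<lambda>n. (cmod (cinner h (\<omega> n)))\<^sup>2)"
    "\<And>h. (\<Sum>n. (cmod (cinner h (\<omega> n)))\<^sup>2) \<le> B * (norm h)\<^sup>2"
    using assms unfolding bessel_def by auto
  show thesis
  proof (rule that[OF B(1)])
    fix c :: "nat \<Rightarrow> complex" and F :: "nat set"
    assume F: "finite F"
    define y where "y = (\<Sum>n\<in>F. c n *\<^sub>C \<omega> n)"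
    have "(norm y)\<^sup>2 = cmod (cinner y y)"
      by (simp add: cinner_self norm_power)
    also have "cinner y y = (\<Sum>n\<in>F. c n * cinner (\<omega> n) y)"
      by (subst (1) y_def) (simp add: cinner.sum_left cinner_scaleC_left)
    also have "cmod \<dots> \<le> (\<Sum>n\<in>F. cmod (c n) * cmod (cinner y (\<omega> n)))"
      by (rule order_trans[OF norm_sum]) (simp add: norm_mult norm_cinner_commute[of y])
    finally have "((norm y)\<^sup>2)\<^sup>2 \<le> (\<Sum>n\<in>F. cmod (c n) * cmod (cinner y (\<omega> n)))\<^sup>2"
      by (intro power_mono) auto
    also have "\<dots> \<le> (\<Sum>n\<in>F. (cmod (c n))\<^sup>2) * (\<Sum>n\<in>F. (cmod (cinner y (\<omega> n)))\<^sup>2)"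
      by (rule Cauchy_Schwarz_ineq_sum)
    also have "\<dots> \<le> (\<Sum>n\<in>F. (cmod (c n))\<^sup>2) * (B * (norm y)\<^sup>2)"
      by (intro mult_left_mono order_trans[OF sum_le_suminf[OF B(2) F] B(3)]) (auto intro: sum_nonneg)
    finally have *: "(norm y)\<^sup>2 * (norm y)\<^sup>2 \<le> (B * (\<Sum>n\<in>F. (cmod (c n))\<^sup>2)) * (norm y)\<^sup>2"
      by (simp add: power2_eq_square mult_ac)
    have "(norm y)\<^sup>2 \<le> B * (\<Sum>n\<in>F. (cmod (c n))\<^sup>2)"
    proof (cases "y = 0")
      case False
      with * show ?thesis by (metis mult_le_cancel_right not_le zero_less_norm_iff zero_less_power)
    qed (use B(1) in \<open>simp add: sum_nonneg\<close>)
    then show "(norm (\<Sum>n\<in>F. c n *\<^sub>C \<omega> n))\<^sup>2 \<le> B * (\<Sum>n\<in>F. (cmod (c n))\<^sup>2)"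
      by (simp add: y_def)
  qed
qed

text \<open>With the coefficients \<open>cinner h (\<omega> n)\<close> the combination y satisfies
  <y, h> = s, the partial sum to be bounded. Cauchy-Schwarz then gives s^2 \<le> C s |h|^2, and s
  cancels.\<close>

lemma synthesis_bound_imp_bessel:
  fixes \<omega> :: "nat \<Rightarrow> 'a::complex_hilbert"
  assumes B: "\<And>c N. (norm (\<Sum>n<N. c n *\<^sub>C \<omega> n))\<^sup>2 \<le> B * (\<Sum>n<N. (cmod (c n))\<^sup>2)"
  shows "bessel \<omega>"
proof -
  define C where "C = max B 1"
  have C: "(norm (\<Sum>n<N. c n *\<^sub>C \<omega> n))\<^sup>2 \<le> C * (\<Sum>n<N. (cmod (c n))\<^sup>2)" for c N
    by (rule order_trans[OF B]) (auto simp: C_def intro!: mult_right_mono sum_nonneg)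
  have "(\<Sum>n<N. (cmod (cinner h (\<omega> n)))\<^sup>2) \<le> C * (norm h)\<^sup>2" for h N
  proof -
    define s where "s = (\<Sum>n<N. (cmod (cinner h (\<omega> n)))\<^sup>2)"
    define y where "y = (\<Sum>n<N. cinner h (\<omega> n) *\<^sub>C \<omega> n)"
    have "cinner y h = (\<Sum>n<N. cinner h (\<omega> n) * cnj (cinner h (\<omega> n)))"
      unfolding y_def cinner.sum_left cinner_scaleC_left by (metis cinner_commute)
    also have "\<dots> = complex_of_real s"
      by (simp only: s_def complex_norm_square of_real_sum)
    finally have "cmod (cinner y h) = s"
      by (simp only: norm_of_real) (simp add: s_def sum_nonneg)
    then have "s \<le> norm y * norm h" using norm_cinner_le[of y h] by simp
    then have "s\<^sup>2 \<le> (norm y * norm h)\<^sup>2" by (intro power_mono) (auto simp: s_def sum_nonneg)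
    also have "\<dots> \<le> C * s * (norm h)\<^sup>2"
      unfolding power_mult_distrib by (intro mult_right_mono) (auto simp: y_def s_def C)
    finally have "s * s \<le> (C * (norm h)\<^sup>2) * s" by (simp add: power2_eq_square mult_ac)
    moreover have "s \<ge> 0" by (simp add: s_def sum_nonneg)
    ultimately have "s \<le> C * (norm h)\<^sup>2"
      by (cases "s = 0") (auto simp: C_def mult_le_cancel_right)
    then show ?thesis by (simp add: s_def)
  qed
  then show ?thesis by (rule besselI)
qed

lemma bessel_summable:
  fixes \<omega> :: "nat \<Rightarrow> 'a::complex_hilbert"
  assumes "bessel \<omega>" "summable (\<lambda>n. (cmod (c n))\<^sup>2)"
  shows "summable (\<lambda>n. c n *\<^sub>C \<omega> n)"
proof -
  obtain B where B: "B > 0"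
    "\<And>c F. finite F \<Longrightarrow> (norm (\<Sum>n\<in>F. c n *\<^sub>C \<omega> n))\<^sup>2 \<le> B * (\<Sum>n\<in>F. (cmod (c n))\<^sup>2)"
    using bessel_imp_synthesis_bound[OF assms(1)] by blast
  show ?thesis unfolding summable_Cauchy[of "\<lambda>n. c n *\<^sub>C \<omega> n"]
  proof (intro allI impI)
    fix \<epsilon> :: real
    assume "\<epsilon> > 0"
    then have "\<epsilon>\<^sup>2 / B > 0" using B(1) by simp
    then obtain N where N: "\<And>m n. m \<ge> N \<Longrightarrow> norm (\<Sum>k=m..<n. (cmod (c k))\<^sup>2) < \<epsilon>\<^sup>2 / B"
      using assms(2) unfolding summable_Cauchy by blast
    have "norm (\<Sum>k=m..<n. c k *\<^sub>C \<omega> k) < \<epsilon>" if "m \<ge> N" for m n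
    proof -
      have "(norm (\<Sum>k=m..<n. c k *\<^sub>C \<omega> k))\<^sup>2 \<le> B * (\<Sum>k=m..<n. (cmod (c k))\<^sup>2)"
        by (rule B(2)) simp
      also have "\<dots> < \<epsilon>\<^sup>2"
        using N[OF that, of n] B(1) by (simp add: sum_nonneg field_simps)
      finally show ?thesis using \<open>\<epsilon> > 0\<close> by (simp add: power_less_imp_less_base)
    qed
    then show "\<exists>N. \<forall>m\<ge>N. \<forall>n. norm (\<Sum>k=m..<n. c k *\<^sub>C \<omega> k) < \<epsilon>" by blast
  qed
qed

lemma bessel_synthesis_bound:
  fixes \<omega> :: "nat \<Rightarrow> 'a::complex_hilbert"
  assumes "bessel \<omega>"
  obtains B where "B > 0" "\<And>c. summable (\<lambda>n. (cmod (c n))\<^sup>2) \<Longrightarrow>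
    (norm (\<Sum>n. c n *\<^sub>C \<omega> n))\<^sup>2 \<le> B * (\<Sum>n. (cmod (c n))\<^sup>2)"
proof -
  obtain B where B: "B > 0"
    "\<And>c F. finite F \<Longrightarrow> (norm (\<Sum>n\<in>F. c n *\<^sub>C \<omega> n))\<^sup>2 \<le> B * (\<Sum>n\<in>F. (cmod (c n))\<^sup>2)"
    using bessel_imp_synthesis_bound[OF assms(1)] by blast
  show thesis
  proof (rule that[OF B(1)])
    fix c :: "nat \<Rightarrow> complex"
    assume c: "summable (\<lambda>n. (cmod (c n))\<^sup>2)"
    have "(\<lambda>N. (norm (\<Sum>n<N. c n *\<^sub>C \<omega> n))\<^sup>2) \<longlonglongrightarrow> (norm (\<Sum>n. c n *\<^sub>C \<omega> n))\<^sup>2"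
      by (intro tendsto_intros summable_LIMSEQ bessel_summable assms c)
    moreover have "(norm (\<Sum>n<N. c n *\<^sub>C \<omega> n))\<^sup>2 \<le> B * (\<Sum>n. (cmod (c n))\<^sup>2)" for N
      by (rule order_trans[OF B(2)]) (auto intro!: mult_left_mono sum_le_suminf c less_imp_le[OF B(1)])
    ultimately show "(norm (\<Sum>n. c n *\<^sub>C \<omega> n))\<^sup>2 \<le> B * (\<Sum>n. (cmod (c n))\<^sup>2)"
      by (intro LIMSEQ_le_const2) auto
  qed
qed

section \<open>Norm bounds and rescaling of Bessel sequences\<close>

lemma NBB_iff: "NBB x \<longleftrightarrow> (\<exists>a>0. \<forall>n. a \<le> norm (x n))"
proof
  assume "NBB x"
  moreover have "(INF n. norm (x n)) \<le> norm (x n)" for n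
    by (rule cINF_lower) (auto intro: bdd_belowI[of _ 0])
  ultimately show "\<exists>a>0. \<forall>n. a \<le> norm (x n)" unfolding NBB_def by blast
next
  assume "\<exists>a>0. \<forall>n. a \<le> norm (x n)"
  then obtain a where "a > 0" "\<And>n. a \<le> norm (x n)" by blast
  then have "a \<le> (INF n. norm (x n))" by (intro cINF_greatest) auto
  with \<open>a > 0\<close> show "NBB x" unfolding NBB_def by linarith
qed

lemma NBA_iff: "NBA x \<longleftrightarrow> (\<exists>b. \<forall>n. norm (x n) \<le> b)"
  by (auto simp: NBA_def bdd_above_def)

lemma ell_infty_iff: "m \<in> ell_infty \<longleftrightarrow> (\<exists>b. \<forall>n. cmod (m n) \<le> b)"
  by (auto simp: ell_infty_def bounded_iff)

lemma bessel_norm_bounded: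
  fixes \<omega> :: "nat \<Rightarrow> 'a::complex_hilbert"
  assumes "bessel \<omega>"
  obtains C where "C > 0" "\<And>n. norm (\<omega> n) \<le> C"
proof -
  obtain B where B: "B > 0"
    "\<And>c F. finite F \<Longrightarrow> (norm (\<Sum>n\<in>F. c n *\<^sub>C \<omega> n))\<^sup>2 \<le> B * (\<Sum>n\<in>F. (cmod (c n))\<^sup>2)"
    using bessel_imp_synthesis_bound[OF assms(1)] by blast
  have "(norm (\<omega> n))\<^sup>2 \<le> B" for n
    using B(2)[of "{n}" "\<lambda>_. 1"] by simp
  then show thesis
    using B(1) by (intro that[of "sqrt B"]) (auto simp: real_le_rsqrt)
qed

lemma bessel_imp_NBA:
  fixes \<omega> :: "nat \<Rightarrow> 'a::complex_hilbert"
  assumes "bessel \<omega>"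
  shows "NBA \<omega>"
proof -
  obtain C where "\<And>n. norm (\<omega> n) \<le> C"
    using bessel_norm_bounded[OF assms] by blast
  then show ?thesis unfolding NBA_iff by blast
qed

lemma bessel_scale:
  fixes \<omega> :: "nat \<Rightarrow> 'a::complex_hilbert"
  assumes "bessel \<omega>" and m: "\<And>n. cmod (m n) \<le> b"
  shows "bessel (\<lambda>n. m n *\<^sub>C \<omega> n)"
proof -
  obtain B where B: "B > 0"
    "\<And>c F. finite F \<Longrightarrow> (norm (\<Sum>n\<in>F. c n *\<^sub>C \<omega> n))\<^sup>2 \<le> B * (\<Sum>n\<in>F. (cmod (c n))\<^sup>2)"
    using bessel_imp_synthesis_bound[OF assms(1)] by blast
  show ?thesis
  proof (rule synthesis_bound_imp_bessel)
    fix c N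
    have "(norm (\<Sum>n<N. c n *\<^sub>C m n *\<^sub>C \<omega> n))\<^sup>2 = (norm (\<Sum>n<N. (c n * m n) *\<^sub>C \<omega> n))\<^sup>2"
      by (simp add: scaleC_scaleC)
    also have "\<dots> \<le> B * (\<Sum>n<N. (cmod (c n * m n))\<^sup>2)" by (rule B(2)) simp
    also have "\<dots> \<le> B * (\<Sum>n<N. b\<^sup>2 * (cmod (c n))\<^sup>2)"
      by (intro mult_left_mono sum_mono less_imp_le[OF B(1)])
        (simp add: norm_mult power_mult_distrib mult.commute[of "b\<^sup>2"] mult_left_mono power_mono m)
    finally show "(norm (\<Sum>n<N. c n *\<^sub>C m n *\<^sub>C \<omega> n))\<^sup>2 \<le> (B * b\<^sup>2) * (\<Sum>n<N. (cmod (c n))\<^sup>2)"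
      by (simp add: sum_distrib_left mult.assoc)
  qed
qed

section \<open>Synthesis and analysis operators\<close>

text \<open>The inverse clause of \<open>multiplier_invertible\<close> for a general operator, with
  boundedness of T included. Multipliers built from Bessel sequences have this boundedness as
  compositions of synthesis and analysis operators.\<close>

definition cinvertible :: "('a::complex_hilbert \<Rightarrow> 'a) \<Rightarrow> bool" where
  "cinvertible T \<longleftrightarrow> bounded_clinear T \<and>
    (\<exists>G. bounded_clinear G \<and> (\<forall>f. G (T f) = f) \<and> (\<forall>f. T (G f) = f))"

lemma cinner_eqI:
  assumes "\<And>h. cinner h x = cinner h y"
  shows "x = y"
proof -
  have "cinner (x - y) (x - y) = 0" using assms by (simp add: cinner.diff_right)
  then show ?thesis by (simp add: cinner_self_eq_0)
qed

lemma bounded_clinearI: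
  fixes T :: "'a::complex_hilbert \<Rightarrow> 'a"
  assumes add: "\<And>x y. T (x + y) = T x + T y" and scale: "\<And>c x. T (c *\<^sub>C x) = c *\<^sub>C T x"
    and bound: "\<And>x. (norm (T x))\<^sup>2 \<le> B * (norm x)\<^sup>2"
  shows "bounded_clinear T"
proof -
  have "norm (T x) \<le> norm x * sqrt (max B 0)" for x
  proof -
    have "(norm (T x))\<^sup>2 \<le> max B 0 * (norm x)\<^sup>2"
      by (rule order_trans[OF bound mult_right_mono]) auto
    then have "norm (T x) \<le> sqrt (max B 0 * (norm x)\<^sup>2)" by (rule real_le_rsqrt)
    then show ?thesis by (simp add: real_sqrt_mult mult.commute)
  qed
  then have "bounded_linear T"
    by (intro bounded_linear_intro[where K = "sqrt (max B 0)"])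
      (simp_all add: add scale flip: scaleC_of_real)
  then show ?thesis by (simp add: bounded_clinear_def scale)
qed

lemma bounded_clinear_compose:
  "bounded_clinear S \<Longrightarrow> bounded_clinear T \<Longrightarrow> bounded_clinear (\<lambda>x. S (T x))"
  by (auto simp: bounded_clinear_def intro: bounded_linear_compose)

lemma cinvertible_compose:
  assumes "cinvertible S" "cinvertible T"
  shows "cinvertible (\<lambda>x. S (T x))"
proof -
  obtain G where G: "bounded_clinear G" "\<And>f. G (S f) = f" "\<And>f. S (G f) = f"
    using assms(1) unfolding cinvertible_def by blast
  obtain H where H: "bounded_clinear H" "\<And>f. H (T f) = f" "\<And>f. T (H f) = f"
    using assms(2) unfolding cinvertible_def by blast
  show ?thesis using assms G H unfolding cinvertible_def
    by (intro conjI exI[of _ "\<lambda>x. H (G x)"]) (auto intro: bounded_clinear_compose)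
qed

text \<open>Composing with the inverse of S removes it. This and its right-hand counterpart strip
  from a multiplier the factor contributed by the Riesz basis.\<close>

lemma cinvertible_compose_left_iff:
  assumes "cinvertible S" "bounded_clinear T"
  shows "cinvertible (\<lambda>x. S (T x)) \<longleftrightarrow> cinvertible T"
proof
  assume *: "cinvertible (\<lambda>x. S (T x))"
  obtain G where G: "bounded_clinear G" "\<And>f. G (S f) = f" "\<And>f. S (G f) = f"
    using assms(1) unfolding cinvertible_def by blast
  then have "cinvertible G" using assms(1) unfolding cinvertible_def by blast
  from cinvertible_compose[OF this *] show "cinvertible T" by (simp add: G)
qed (rule cinvertible_compose[OF assms(1)])

lemma cinvertible_compose_right_iff:
  assumes "cinvertible T" "bounded_clinear S"
  shows "cinvertible (\<lambda>x. S (T x)) \<longleftrightarrow> cinvertible S"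
proof
  assume *: "cinvertible (\<lambda>x. S (T x))"
  obtain G where G: "bounded_clinear G" "\<And>f. G (T f) = f" "\<And>f. T (G f) = f"
    using assms(1) unfolding cinvertible_def by blast
  then have "cinvertible G" using assms(1) unfolding cinvertible_def by blast
  from cinvertible_compose[OF * this] show "cinvertible S" by (simp add: G)
qed (rule cinvertible_compose[OF _ assms(1)])

lemma bessel_image:
  fixes e :: "nat \<Rightarrow> 'a::complex_hilbert"
  assumes "bessel e" "bounded_clinear T"
  shows "bessel (\<lambda>n. T (e n))"
proof -
  obtain B where B: "B > 0"
    "\<And>c F. finite F \<Longrightarrow> (norm (\<Sum>n\<in>F. c n *\<^sub>C e n))\<^sup>2 \<le> B * (\<Sum>n\<in>F. (cmod (c n))\<^sup>2)"
    using bessel_imp_synthesis_bound[OF assms(1)] by blast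
  interpret bounded_linear T using assms(2) by (simp add: bounded_clinear_def)
  obtain K where K: "\<And>x. norm (T x) \<le> norm x * K" using bounded by blast
  show ?thesis
  proof (rule synthesis_bound_imp_bessel)
    fix c N
    have "(norm (\<Sum>n<N. c n *\<^sub>C T (e n)))\<^sup>2 = (norm (T (\<Sum>n<N. c n *\<^sub>C e n)))\<^sup>2"
      using assms(2) by (simp add: sum bounded_clinear_def)
    also have "\<dots> \<le> (norm (\<Sum>n<N. c n *\<^sub>C e n) * K)\<^sup>2" by (intro power_mono K) simp
    also have "\<dots> \<le> (B * (\<Sum>n<N. (cmod (c n))\<^sup>2)) * K\<^sup>2"
      unfolding power_mult_distrib by (intro mult_right_mono B(2)) auto
    finally show "(norm (\<Sum>n<N. c n *\<^sub>C T (e n)))\<^sup>2 \<le> (B * K\<^sup>2) * (\<Sum>n<N. (cmod (c n))\<^sup>2)"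
      by (simp add: mult_ac)
  qed
qed

lemma riesz_basis_imp_bessel:
  assumes "riesz_basis \<omega>"
  shows "bessel \<omega>"
proof -
  obtain B where B: "\<And>c. summable (\<lambda>n. (cmod (c n))\<^sup>2) \<Longrightarrow>
      (norm (\<Sum>n. c n *\<^sub>C \<omega> n))\<^sup>2 \<le> B * (\<Sum>n. (cmod (c n))\<^sup>2)"
    using assms unfolding riesz_basis_def by blast
  show ?thesis
  proof (rule synthesis_bound_imp_bessel)
    fix c :: "nat \<Rightarrow> complex" and N
    \<comment> \<open>The Riesz inequality speaks of infinite series, so the finite coefficient
      family is padded with zeros.\<close>
    define d where "d n = (if n < N then c n else 0)" for n
    have "(\<lambda>n. (cmod (d n))\<^sup>2) sums (\<Sum>n<N. (cmod (d n))\<^sup>2)"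
      and "(\<lambda>n. d n *\<^sub>C \<omega> n) sums (\<Sum>n<N. d n *\<^sub>C \<omega> n)"
      by (intro sums_finite; simp add: d_def)+
    then have "(norm (\<Sum>n<N. d n *\<^sub>C \<omega> n))\<^sup>2 \<le> B * (\<Sum>n<N. (cmod (d n))\<^sup>2)"
      using B[of d] by (simp add: sums_iff)
    then show "(norm (\<Sum>n<N. c n *\<^sub>C \<omega> n))\<^sup>2 \<le> B * (\<Sum>n<N. (cmod (c n))\<^sup>2)"
      by (simp add: d_def)
  qed
qed

text \<open>Totality is stated as a trivial orthogonal complement because this is what maximality of
  an orthonormal set delivers; the series expansion is derived from it.\<close>

locale orthonormal_basis =
  fixes e :: "nat \<Rightarrow> 'a::complex_hilbert"
  assumes orthonormal: "cinner (e i) (e j) = of_bool (i = j)"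
    and total: "(\<And>n. cinner x (e n) = 0) \<Longrightarrow> x = 0"
begin

lemma norm_sum_basis:
  assumes "finite F"
  shows "(norm (\<Sum>n\<in>F. c n *\<^sub>C e n))\<^sup>2 = (\<Sum>n\<in>F. (cmod (c n))\<^sup>2)"
proof -
  have "complex_of_real ((norm (\<Sum>n\<in>F. c n *\<^sub>C e n))\<^sup>2) =
      (\<Sum>i\<in>F. \<Sum>j\<in>F. c j * cnj (c i) * of_bool (j = i))"
    unfolding cinner_self[symmetric]
    by (simp add: cinner.sum_left cinner.sum_right cinner_scaleC_left cinner_scaleC_right
        orthonormal sum_distrib_left mult_ac)
  also have "\<dots> = (\<Sum>i\<in>F. c i * cnj (c i))"
    using assms by (simp add: of_bool_def if_distrib cong: if_cong)
  also have "\<dots> = complex_of_real (\<Sum>n\<in>F. (cmod (c n))\<^sup>2)"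
    by (simp only: of_real_sum complex_norm_square)
  finally show ?thesis by (simp only: of_real_eq_iff)
qed

lemma bessel_basis: "bessel e"
  by (rule synthesis_bound_imp_bessel[of _ 1]) (simp add: norm_sum_basis)

lemma coeff_square_summable: "bessel \<omega> \<Longrightarrow> summable (\<lambda>n. (cmod (cinner f (\<omega> n)))\<^sup>2)"
  for \<omega> :: "nat \<Rightarrow> 'a"
  by (auto simp: bessel_def)

lemma cinner_suminf_basis:
  assumes "summable (\<lambda>n. (cmod (c n))\<^sup>2)"
  shows "cinner (\<Sum>n. c n *\<^sub>C e n) (e k) = c k"
proof -
  have "(\<lambda>n. cinner (c n *\<^sub>C e n) (e k)) sums cinner (\<Sum>n. c n *\<^sub>C e n) (e k)"
    by (intro cinner_sums_left summable_sums bessel_summable bessel_basis assms)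
  moreover have "(\<lambda>n. cinner (c n *\<^sub>C e n) (e k)) = (\<lambda>n. if n = k then c n else 0)"
    by (auto simp: cinner_scaleC_left orthonormal)
  ultimately show ?thesis
    using sums_single[of k c] by (simp add: sums_iff)
qed

lemma eq_iff_coeffs: "x = y \<longleftrightarrow> (\<forall>n. cinner x (e n) = cinner y (e n))"
  using total[of "x - y"] by (auto simp: cinner.diff_left)

text \<open>The series converges since the coefficients are square summable, and its sum has the
  same coefficients as f, hence equals f by totality.\<close>

lemma expansion: "(\<lambda>n. cinner f (e n) *\<^sub>C e n) sums f"
proof -
  have *: "summable (\<lambda>n. (cmod (cinner f (e n)))\<^sup>2)"
    by (rule coeff_square_summable[OF bessel_basis])
  then have "(\<Sum>n. cinner f (e n) *\<^sub>C e n) = f"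
    by (subst eq_iff_coeffs) (simp add: cinner_suminf_basis)
  then show ?thesis
    using bessel_summable[OF bessel_basis *] by (simp add: sums_iff)
qed

lemma parseval: "(\<lambda>n. (cmod (cinner f (e n)))\<^sup>2) sums (norm f)\<^sup>2"
proof -
  have "(\<lambda>N. (norm (\<Sum>n<N. cinner f (e n) *\<^sub>C e n))\<^sup>2) \<longlonglongrightarrow> (norm f)\<^sup>2"
    using expansion[of f] unfolding sums_def by (intro tendsto_intros)
  then show ?thesis by (simp add: sums_def norm_sum_basis)
qed

text \<open>Identifying \<open>\<ell>\<^sup>2\<close> with the Hilbert space through the basis \<open>e\<close> turns the synthesis
  and the analysis operator of a sequence into operators on the Hilbert space itself.\<close>

definition syn :: "(nat \<Rightarrow> 'a) \<Rightarrow> 'a \<Rightarrow> 'a" where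
  "syn \<omega> f = (\<Sum>n. cinner f (e n) *\<^sub>C \<omega> n)"

definition ana :: "(nat \<Rightarrow> 'a) \<Rightarrow> 'a \<Rightarrow> 'a" where
  "ana \<omega> f = (\<Sum>n. cinner f (\<omega> n) *\<^sub>C e n)"

lemma syn_sums: "bessel \<omega> \<Longrightarrow> (\<lambda>n. cinner f (e n) *\<^sub>C \<omega> n) sums syn \<omega> f"
  unfolding syn_def
  by (intro summable_sums bessel_summable coeff_square_summable[OF bessel_basis])

lemma syn_basis [simp]: "syn \<omega> (e k) = \<omega> k"
proof -
  have "(\<lambda>n. cinner (e k) (e n) *\<^sub>C \<omega> n) = (\<lambda>n. if n = k then \<omega> n else 0)"
    by (auto simp: orthonormal)
  then show ?thesis
    using sums_single[of k \<omega>] by (simp add: syn_def sums_iff)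
qed

lemma cinner_ana: "bessel \<omega> \<Longrightarrow> cinner (ana \<omega> f) (e n) = cinner f (\<omega> n)"
  unfolding ana_def by (intro cinner_suminf_basis coeff_square_summable)

lemma bounded_clinear_syn:
  assumes "bessel \<omega>"
  shows "bounded_clinear (syn \<omega>)"
proof -
  obtain B where B: "\<And>c. summable (\<lambda>n. (cmod (c n))\<^sup>2) \<Longrightarrow>
      (norm (\<Sum>n. c n *\<^sub>C \<omega> n))\<^sup>2 \<le> B * (\<Sum>n. (cmod (c n))\<^sup>2)"
    using bessel_synthesis_bound[OF assms] by metis
  show ?thesis
  proof (rule bounded_clinearI)
    show "syn \<omega> (x + y) = syn \<omega> x + syn \<omega> y" for x y
      using sums_unique[OF sums_add[OF syn_sums[OF assms, of x] syn_sums[OF assms, of y]]]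
      by (simp add: syn_def cinner_add_left scaleC_add_left)
    show "syn \<omega> (c *\<^sub>C x) = c *\<^sub>C syn \<omega> x" for c x
      using sums_unique[OF scaleC_sums[OF syn_sums[OF assms, of x], of c]]
      by (simp add: syn_def cinner_scaleC_left scaleC_scaleC)
    show "(norm (syn \<omega> x))\<^sup>2 \<le> B * (norm x)\<^sup>2" for x
      using B[of "\<lambda>n. cinner x (e n)"] parseval[of x] by (simp add: sums_iff syn_def)
  qed
qed

lemma bounded_clinear_ana:
  assumes "bessel \<omega>"
  shows "bounded_clinear (ana \<omega>)"
proof -
  obtain B where B: "\<And>h. (\<Sum>n. (cmod (cinner h (\<omega> n)))\<^sup>2) \<le> B * (norm h)\<^sup>2"
    using assms unfolding bessel_def by auto
  show ?thesis
  proof (rule bounded_clinearI)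
    show "ana \<omega> (x + y) = ana \<omega> x + ana \<omega> y" for x y
      by (subst eq_iff_coeffs) (simp add: cinner_ana[OF assms] cinner_add_left)
    show "ana \<omega> (c *\<^sub>C x) = c *\<^sub>C ana \<omega> x" for c x
      by (subst eq_iff_coeffs) (simp add: cinner_ana[OF assms] cinner_scaleC_left)
    show "(norm (ana \<omega> x))\<^sup>2 \<le> B * (norm x)\<^sup>2" for x
      using B[of x] parseval[of "ana \<omega> x"] by (simp add: sums_iff cinner_ana[OF assms])
  qed
qed

lemma cinner_syn_ana:
  assumes "bessel \<omega>"
  shows "cinner (syn \<omega> f) g = cinner f (ana \<omega> g)"
proof -
  have "(\<lambda>n. cinner (cinner f (e n) *\<^sub>C \<omega> n) g) sums cinner (syn \<omega> f) g"
    by (intro cinner_sums_left syn_sums assms)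
  moreover have "(\<lambda>n. cinner (cinner f (e n) *\<^sub>C e n) (ana \<omega> g)) sums cinner f (ana \<omega> g)"
    by (intro cinner_sums_left expansion)
  moreover have "cinner (\<omega> n) g = cinner (e n) (ana \<omega> g)" for n
    using cinner_ana[OF assms, of g n] by (subst (1 2) cinner_commute) simp
  ultimately show ?thesis
    by (simp add: cinner_scaleC_left sums_iff)
qed

text \<open>Every bounded operator is thus a synthesis operator, so its adjoint can be written down
  explicitly as an analysis operator.\<close>

lemma eq_syn:
  assumes "bounded_clinear T"
  shows "T f = syn (\<lambda>n. T (e n)) f"
proof -
  have "(\<lambda>n. T (cinner f (e n) *\<^sub>C e n)) sums T f"
    using assms bounded_linear.sums[OF _ expansion, of T f] unfolding bounded_clinear_def by blast
  then show ?thesis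
    using assms by (simp add: syn_def bounded_clinear_def sums_iff)
qed

text \<open>The adjoint of the inverse of \<open>S\<close> is the analysis operator of the images of the basis.\<close>

lemma cinvertible_adjoint:
  fixes S T :: "'a \<Rightarrow> 'a"
  assumes "cinvertible S" "bounded_clinear T" and adj: "\<And>f g. cinner (S f) g = cinner f (T g)"
  shows "cinvertible T"
proof -
  obtain G where G: "bounded_clinear G" "\<And>f. G (S f) = f" "\<And>f. S (G f) = f"
    using assms(1) unfolding cinvertible_def by blast
  define \<gamma> where "\<gamma> = (\<lambda>n. G (e n))"
  have \<gamma>: "bessel \<gamma>" unfolding \<gamma>_def by (rule bessel_image[OF bessel_basis G(1)])
  have G': "cinner (G f) g = cinner f (ana \<gamma> g)" for f g
    using cinner_syn_ana[OF \<gamma>, of f g] eq_syn[OF G(1), of f] by (simp add: \<gamma>_def)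
  \<comment> \<open>Pairing with h moves the operators to the left slot, where they become S (G h) =
    h and G (S h) = h.\<close>
  have "ana \<gamma> (T f) = f" "T (ana \<gamma> f) = f" for f
    by (rule cinner_eqI, simp add: G flip: G' adj)+
  then show ?thesis
    unfolding cinvertible_def using assms(2) bounded_clinear_ana[OF \<gamma>] by blast
qed

lemma cinvertible_syn_iff_ana:
  assumes "bessel \<omega>"
  shows "cinvertible (syn \<omega>) \<longleftrightarrow> cinvertible (ana \<omega>)"
proof
  show "cinvertible (ana \<omega>)" if "cinvertible (syn \<omega>)"
    by (rule cinvertible_adjoint[OF that bounded_clinear_ana[OF assms] cinner_syn_ana[OF assms]])
  show "cinvertible (syn \<omega>)" if "cinvertible (ana \<omega>)"
    by (rule cinvertible_adjoint[OF that bounded_clinear_syn[OF assms]])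
      (subst (1 2) cinner_commute, simp add: cinner_syn_ana[OF assms])
qed

text \<open>By Parseval the two Riesz inequalities are a lower and an upper bound for
  \<open>syn \<omega>\<close>. The lower bound gives injectivity and a closed range, completeness of
  the sequence gives a dense range, hence a bijection. Conversely, the norm of the inverse yields
  the lower Riesz constant.\<close>

lemma riesz_basis_iff:
  "riesz_basis \<omega> \<longleftrightarrow> bessel \<omega> \<and> cinvertible (syn \<omega>)"
proof safe
  assume \<omega>: "riesz_basis \<omega>"
  then show bes: "bessel \<omega>" by (rule riesz_basis_imp_bessel)
  obtain A where "A > 0" and A: "\<And>c. summable (\<lambda>n. (cmod (c n))\<^sup>2) \<Longrightarrow>
      A * (\<Sum>n. (cmod (c n))\<^sup>2) \<le> (norm (\<Sum>n. c n *\<^sub>C \<omega> n))\<^sup>2"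
    and dense: "closure (cspan (range \<omega>)) = UNIV"
    using \<omega> unfolding riesz_basis_def by blast
  have lower: "A * (norm f)\<^sup>2 \<le> (norm (syn \<omega> f))\<^sup>2" for f
    using A[of "\<lambda>n. cinner f (e n)"] parseval[of f] by (simp add: sums_iff syn_def)
  have bcl: "bounded_clinear (syn \<omega>)" by (rule bounded_clinear_syn[OF bes])
  then have bl: "bounded_linear (syn \<omega>)" and cscale: "\<And>c x. syn \<omega> (c *\<^sub>C x) = c *\<^sub>C syn \<omega> x"
    by (auto simp: bounded_clinear_def)
  interpret bounded_linear "syn \<omega>" by (rule bl)
  have "sqrt A * norm f \<le> norm (syn \<omega> f)" for f
    using real_sqrt_le_mono[OF lower[of f]] by (simp add: real_sqrt_mult)
  \<comment> \<open>An operator bounded below maps complete sets to complete sets.\<close>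
  then have "complete (range (syn \<omega>))"
    by (intro complete_isometric_image[of "sqrt A"] bl complete_UNIV) (auto simp: \<open>A > 0\<close>)
  then have "closed (range (syn \<omega>))" by (simp add: complete_eq_closed)
  moreover have "cspan (range \<omega>) \<subseteq> range (syn \<omega>)"
    unfolding cspan_def
  proof (rule complex_vector.span_minimal)
    show "range \<omega> \<subseteq> range (syn \<omega>)" by (metis image_subsetI rangeI syn_basis)
    show "complex_vector.subspace (range (syn \<omega>))"
      unfolding complex_vector.subspace_def
    proof safe
      show "0 \<in> range (syn \<omega>)" by (rule range_eqI[of _ _ 0]) (simp add: zero)
      show "syn \<omega> x + syn \<omega> y \<in> range (syn \<omega>)" for x y
        by (rule range_eqI[of _ _ "x + y"]) (simp add: add)
      show "c *\<^sub>C syn \<omega> x \<in> range (syn \<omega>)" for c x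
        by (rule range_eqI[of _ _ "c *\<^sub>C x"]) (simp add: cscale)
    qed
  qed
  ultimately have surj: "range (syn \<omega>) = UNIV"
    using dense closure_minimal[of "cspan (range \<omega>)" "range (syn \<omega>)"] by auto
  have inj: "inj (syn \<omega>)"
  proof (rule injI)
    fix x y
    assume "syn \<omega> x = syn \<omega> y"
    then have "A * (norm (x - y))\<^sup>2 \<le> 0" using lower[of "x - y"] by (simp add: diff)
    then show "x = y" using \<open>A > 0\<close> by (simp add: mult_le_0_iff)
  qed
  define G where "G = inv (syn \<omega>)"
  have G: "G (syn \<omega> f) = f" "syn \<omega> (G f) = f" for f
    by (simp_all add: G_def inj surj surj_f_inv_f)
  have "bounded_clinear G"
  proof (rule bounded_clinearI)
    show "G (x + y) = G x + G y" for x y by (metis G add)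
    show "G (c *\<^sub>C x) = c *\<^sub>C G x" for c x by (metis G cscale)
    show "(norm (G x))\<^sup>2 \<le> (1 / A) * (norm x)\<^sup>2" for x
      using lower[of "G x"] \<open>A > 0\<close> by (simp add: G field_simps)
  qed
  then show "cinvertible (syn \<omega>)"
    using bcl G unfolding cinvertible_def by blast
next
  assume bes: "bessel \<omega>" and "cinvertible (syn \<omega>)"
  then obtain G where G: "bounded_clinear G" "\<And>f. G (syn \<omega> f) = f" "\<And>f. syn \<omega> (G f) = f"
    unfolding cinvertible_def by blast
  obtain K where "K > 0" and K: "\<And>x. norm (G x) \<le> norm x * K"
    using G(1) bounded_linear.pos_bounded unfolding bounded_clinear_def by blast
  obtain B where "B > 0" and B: "\<And>c. summable (\<lambda>n. (cmod (c n))\<^sup>2) \<Longrightarrow>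
    (norm (\<Sum>n. c n *\<^sub>C \<omega> n))\<^sup>2 \<le> B * (\<Sum>n. (cmod (c n))\<^sup>2)"
    using bessel_synthesis_bound[OF bes] by blast
  have "f \<in> closure (cspan (range \<omega>))" for f
    unfolding closure_sequential
  proof (intro exI conjI allI)
    show "(\<lambda>N. \<Sum>n<N. cinner (G f) (e n) *\<^sub>C \<omega> n) \<longlonglongrightarrow> f"
      using syn_sums[OF bes, of "G f"] by (simp add: G sums_def)
    show "(\<Sum>n<N. cinner (G f) (e n) *\<^sub>C \<omega> n) \<in> cspan (range \<omega>)" for N
      unfolding cspan_def
      by (intro complex_vector.span_sum complex_vector.span_scale complex_vector.span_base) auto
  qed
  moreover have "1 / K\<^sup>2 * (\<Sum>n. (cmod (c n))\<^sup>2) \<le> (norm (\<Sum>n. c n *\<^sub>C \<omega> n))\<^sup>2"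
    if "summable (\<lambda>n. (cmod (c n))\<^sup>2)" for c
  proof -
    define f where "f = (\<Sum>n. c n *\<^sub>C e n)"
    have f: "cinner f (e n) = c n" for n
      unfolding f_def by (rule cinner_suminf_basis[OF that])
    have "norm f \<le> norm (syn \<omega> f) * K" using K[of "syn \<omega> f"] by (simp add: G)
    then have "(norm f)\<^sup>2 \<le> (norm (syn \<omega> f) * K)\<^sup>2" by (rule power_mono) simp
    then show ?thesis using \<open>K > 0\<close> parseval[of f]
      by (simp add: f sums_iff syn_def power_mult_distrib field_simps)
  qed
  \<comment> \<open>The maximum in the upper constant secures A \<le> B, as the definition
    demands.\<close>
  ultimately show "riesz_basis \<omega>"
    unfolding riesz_basis_def using \<open>K > 0\<close> \<open>B > 0\<close> B bessel_summable[OF bes]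
    by (intro conjI exI[of _ "1 / K\<^sup>2"] exI[of _ "max B (1 / K\<^sup>2)"])
      (auto intro!: order_trans[OF B] mult_right_mono suminf_nonneg)
qed

end

section \<open>Existence of an orthonormal basis\<close>

text \<open>Zorn provides a maximal orthonormal set. It is infinite because a finite one would span
  the space, and countable by separability, so the naturals enumerate it.\<close>

lemma ex_orthonormal_basis:
  assumes separable: "\<exists>D :: 'a::complex_hilbert set. countable D \<and> closure D = UNIV"
    and infinite_dimensional: "\<not> (\<exists>S :: 'a set. finite S \<and> cspan S = UNIV)"
  obtains e :: "nat \<Rightarrow> 'a::complex_hilbert" where "orthonormal_basis e"
proof -
  define ON where "ON = {B :: 'a set. \<forall>x\<in>B. \<forall>y\<in>B. cinner x y = of_bool (x = y)}"
  have "\<exists>B\<in>ON. \<forall>X\<in>ON. B \<subseteq> X \<longrightarrow> X = B"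
  proof (rule subset_Zorn')
    fix C
    assume C: "subset.chain ON C"
    have "cinner x y = of_bool (x = y)" if "X \<in> C" "Y \<in> C" "x \<in> X" "y \<in> Y" for X Y x y
    proof -
      have "X \<in> ON" "Y \<in> ON" "X \<subseteq> Y \<or> Y \<subseteq> X"
        using C that unfolding subset_chain_def by auto
      then show ?thesis using that unfolding ON_def by blast
    qed
    then show "\<Union>C \<in> ON" unfolding ON_def by blast
  qed
  then obtain B where "B \<in> ON" and max: "\<And>X. X \<in> ON \<Longrightarrow> B \<subseteq> X \<Longrightarrow> X = B" by blast
  then have B: "\<And>x y. x \<in> B \<Longrightarrow> y \<in> B \<Longrightarrow> cinner x y = of_bool (x = y)"
    by (simp add: ON_def)
  have total: "x = 0" if "\<And>b. b \<in> B \<Longrightarrow> cinner x b = 0" for x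
  proof (rule ccontr)
    assume "x \<noteq> 0"
    \<comment> \<open>A nonzero vector orthogonal to B, once normalized, would enlarge the maximal
      set B.\<close>
    define u where "u = complex_of_real (1 / norm x) *\<^sub>C x"
    have u: "cinner u b = 0" "cinner b u = 0" if "b \<in> B" for b
      using \<open>\<And>b. b \<in> B \<Longrightarrow> cinner x b = 0\<close>[OF that] cinner_commute[of b u]
      by (simp_all add: u_def cinner_scaleC_left)
    have uu: "cinner u u = 1"
      using \<open>x \<noteq> 0\<close> by (simp add: u_def cinner_self norm_scaleC norm_divide)
    then have "u \<notin> B" using u(1)[of u] by auto
    moreover have "insert u B \<in> ON"
      unfolding ON_def using u uu B \<open>u \<notin> B\<close> by auto
    ultimately show False using max[of "insert u B"] by blast
  qed
  have "infinite B"
  proof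
    assume "finite B"
    have "x \<in> cspan B" for x
    proof -
      \<comment> \<open>The difference of x and its projection onto the span of the finite set B is
        orthogonal to B, hence zero.\<close>
      have "cinner (x - (\<Sum>b\<in>B. cinner x b *\<^sub>C b)) y = 0" if "y \<in> B" for y
      proof -
        have "cinner (\<Sum>b\<in>B. cinner x b *\<^sub>C b) y = (\<Sum>b\<in>B. if b = y then cinner x b else 0)"
          unfolding cinner.sum_left
          by (rule sum.cong) (auto simp: cinner_scaleC_left B that)
        then show ?thesis using \<open>finite B\<close> that by (simp add: cinner.diff_left)
      qed
      then have "x = (\<Sum>b\<in>B. cinner x b *\<^sub>C b)" using total by fastforce
      also have "\<dots> \<in> cspan B"
        unfolding cspan_def
        by (intro complex_vector.span_sum complex_vector.span_scale complex_vector.span_base)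
      finally show ?thesis .
    qed
    then show False using infinite_dimensional \<open>finite B\<close> by blast
  qed
  have "countable B"
  proof -
    obtain D :: "'a set" where D: "countable D" "closure D = UNIV" using separable by blast
    have "\<exists>d\<in>D. dist d b < 1 / 2" for b
      using D(2) closure_approachable[of b D] by (metis UNIV_I half_gt_zero zero_less_one)
    then obtain d where d: "\<And>b. d b \<in> D" "\<And>b. dist (d b) b < 1 / 2" by metis
    have "inj_on d B"
    proof (rule inj_onI, rule ccontr)
      fix x y
      assume *: "x \<in> B" "y \<in> B" "d x = d y" "x \<noteq> y"
      \<comment> \<open>Distinct orthonormal vectors are sqrt 2 apart, so they cannot share a point
        of D that is closer than 1/2 to both.\<close>
      have "complex_of_real ((norm (x - y))\<^sup>2) = 2"
        unfolding cinner_self[symmetric] using * by (simp add: cinner.diff_left cinner.diff_right B)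
      then have "(norm (x - y))\<^sup>2 = 2"
        by (metis of_real_eq_iff of_real_numeral)
      moreover have "norm (x - y) < 1"
        using dist_triangle_half_r[of "d x" x 1 y] d(2)[of x] d(2)[of y] *(3)
        by (simp add: dist_norm)
      then have "(norm (x - y))\<^sup>2 < 1\<^sup>2" by (intro power_strict_mono) auto
      ultimately show False by simp
    qed
    moreover have "countable (d ` B)" using d(1) D(1) by (meson countable_subset image_subsetI)
    ultimately show ?thesis by (rule countable_image_inj_on[rotated])
  qed
  define e where "e = from_nat_into B"
  have "bij_betw e UNIV B"
    unfolding e_def by (rule bij_betw_from_nat_into) fact+
  then have e: "inj e" "range e = B" by (auto simp: bij_betw_def)
  have "orthonormal_basis e"
  proof
    show "cinner (e i) (e j) = of_bool (i = j)" for i j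
      using e B[of "e i" "e j"] by (auto simp: inj_eq)
    show "x = 0" if "\<And>n. cinner x (e n) = 0" for x
      using that total[of x] e(2) by auto
  qed
  then show thesis by (rule that)
qed

section \<open>Multipliers of a Riesz basis\<close>

lemma bessel_scale_cnj_iff:
  "bessel (\<lambda>n. cnj (m n) *\<^sub>C \<psi> n) \<longleftrightarrow> bessel (\<lambda>n. m n *\<^sub>C \<psi> n)"
  by (simp add: bessel_def cinner_scaleC_right norm_mult)

lemma bessel_unscale:
  fixes \<psi> :: "nat \<Rightarrow> 'a::complex_hilbert"
  assumes bes: "bessel (\<lambda>n. m n *\<^sub>C \<psi> n)" and "a > 0" and m: "\<And>n. a \<le> cmod (m n)"
  shows "bessel \<psi>"
proof -
  have "bessel (\<lambda>n. (1 / m n) *\<^sub>C m n *\<^sub>C \<psi> n)"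
    by (rule bessel_scale[OF bes, of _ "1 / a"])
      (use m \<open>a > 0\<close> in \<open>simp add: norm_divide frac_le\<close>)
  moreover have "m n \<noteq> 0" for n using m[of n] \<open>a > 0\<close> by auto
  ultimately show ?thesis by (simp add: scaleC_scaleC)
qed

text \<open>The symbol can be absorbed into either sequence. The first form leaves a Riesz basis
  untouched in the synthesis slot, the second in the analysis slot.\<close>

lemma multiplier_well_defined_alt:
  "multiplier_well_defined m \<Phi> \<Psi> \<longleftrightarrow> (\<forall>f. summable (\<lambda>n. cinner f (cnj (m n) *\<^sub>C \<Psi> n) *\<^sub>C \<Phi> n))"
  "multiplier_well_defined m \<Phi> \<Psi> \<longleftrightarrow> (\<forall>f. summable (\<lambda>n. cinner f (\<Psi> n) *\<^sub>C (m n *\<^sub>C \<Phi> n)))"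
  by (simp_all add: multiplier_well_defined_def cinner_scaleC_right scaleC_scaleC mult.commute)

lemma multiplier_alt:
  "multiplier m \<Phi> \<Psi> f = (\<Sum>n. cinner f (cnj (m n) *\<^sub>C \<Psi> n) *\<^sub>C \<Phi> n)"
  "multiplier m \<Phi> \<Psi> f = (\<Sum>n. cinner f (\<Psi> n) *\<^sub>C (m n *\<^sub>C \<Phi> n))"
  by (simp_all add: multiplier_def cinner_scaleC_right scaleC_scaleC mult.commute)

lemma partial_sums_bounded:
  fixes x y :: "nat \<Rightarrow> 'a::complex_hilbert"
  assumes "\<And>f. summable (\<lambda>n. cinner f (x n) *\<^sub>C y n)"
  obtains K where "K > 0" "\<And>N f. norm (\<Sum>n<N. cinner f (x n) *\<^sub>C y n) \<le> K * norm f"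
proof (rule banach_steinhaus)
  show "bounded_linear (\<lambda>f. \<Sum>n<N. cinner f (x n) *\<^sub>C y n)" for N
    by (intro bounded_linear_sum bounded_linear_compose[OF scaleC.bounded_linear_left]
        cinner.bounded_linear_left)
  show "bounded (range (\<lambda>N. \<Sum>n<N. cinner f (x n) *\<^sub>C y n))" for f
    using convergent_imp_bounded[OF summable_LIMSEQ[OF assms]] .
qed (rule that)

section \<open>Rescaled Riesz bases, and criteria for multipliers\<close>

context orthonormal_basis
begin

lemma norm_basis [simp]: "norm (e n) = 1"
  using norm_sum_basis[of "{n}" "\<lambda>_. 1"] power2_eq_iff_nonneg[of "norm (e n)" 1] by simp

lemma riesz_basis_basis: "riesz_basis e"
proof -
  have "syn e = (\<lambda>f. f)" using expansion by (simp add: syn_def sums_iff fun_eq_iff)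
  moreover have "bounded_clinear (\<lambda>f :: 'a. f)"
    by (simp add: bounded_clinear_def bounded_linear_ident)
  ultimately show ?thesis
    unfolding riesz_basis_iff cinvertible_def using bessel_basis by auto
qed

lemma cinner_syn_scaled_basis:
  assumes "\<And>n. cmod (m n) \<le> b"
  shows "cinner (syn (\<lambda>n. m n *\<^sub>C e n) f) (e k) = m k * cinner f (e k)"
proof -
  have "(\<lambda>n. cinner (cinner f (e n) *\<^sub>C m n *\<^sub>C e n) (e k)) sums cinner (syn (\<lambda>n. m n *\<^sub>C e n) f) (e k)"
    by (intro cinner_sums_left syn_sums bessel_scale[OF bessel_basis assms])
  moreover have "(\<lambda>n. cinner (cinner f (e n) *\<^sub>C m n *\<^sub>C e n) (e k)) =
      (\<lambda>n. if n = k then m n * cinner f (e n) else 0)"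
    by (auto simp: cinner_scaleC_left orthonormal)
  ultimately show ?thesis
    using sums_single[of k "\<lambda>n. m n * cinner f (e n)"] by (simp add: sums_iff)
qed

text \<open>The synthesis operator of the scaled sequence is that of \<omega> after the diagonal
  operator with entries \<open>m n\<close>, which is inverted by the one with entries
  \<open>1 / m n\<close>.\<close>

lemma riesz_basis_scale:
  fixes \<omega> :: "nat \<Rightarrow> 'a"
  assumes "riesz_basis \<omega>" "a > 0" and m: "\<And>n. a \<le> cmod (m n)" "\<And>n. cmod (m n) \<le> b"
  shows "riesz_basis (\<lambda>n. m n *\<^sub>C \<omega> n)"
proof -
  have m': "cmod (1 / m n) \<le> 1 / a" for n
    using m(1)[of n] \<open>a > 0\<close> by (simp add: norm_divide frac_le)
  have "m n \<noteq> 0" for n using m(1)[of n] \<open>a > 0\<close> by auto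
  note coeff = cinner_syn_scaled_basis[OF m(2)] cinner_syn_scaled_basis[OF m']
  have "cinvertible (syn (\<lambda>n. m n *\<^sub>C e n))"
    unfolding cinvertible_def
  proof (intro conjI exI allI)
    show "syn (\<lambda>n. (1 / m n) *\<^sub>C e n) (syn (\<lambda>n. m n *\<^sub>C e n) f) = f"
      and "syn (\<lambda>n. m n *\<^sub>C e n) (syn (\<lambda>n. (1 / m n) *\<^sub>C e n) f) = f" for f
      using \<open>\<And>n. m n \<noteq> 0\<close> by (subst eq_iff_coeffs, simp add: coeff)+
  qed (intro bounded_clinear_syn bessel_scale[OF bessel_basis m(2)] bessel_scale[OF bessel_basis m'])+
  then have "cinvertible (\<lambda>f. syn \<omega> (syn (\<lambda>n. m n *\<^sub>C e n) f))"
    using cinvertible_compose[of "syn \<omega>"] assms(1) by (simp add: riesz_basis_iff)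
  moreover have "syn \<omega> (syn (\<lambda>n. m n *\<^sub>C e n) f) = syn (\<lambda>n. m n *\<^sub>C \<omega> n) f" for f
    unfolding syn_def[of \<omega>] coeff by (simp add: syn_def scaleC_scaleC mult.commute)
  moreover have "bessel (\<lambda>n. m n *\<^sub>C \<omega> n)"
    by (rule bessel_scale[OF riesz_basis_imp_bessel[OF assms(1)] m(2)])
  ultimately show ?thesis by (simp add: riesz_basis_iff)
qed

lemma riesz_basis_scale_SN_iff:
  fixes \<omega> :: "nat \<Rightarrow> 'a"
  assumes "SN m"
  shows "riesz_basis (\<lambda>n. m n *\<^sub>C \<omega> n) \<longleftrightarrow> riesz_basis \<omega>"
proof
  obtain a b where "a > 0" and m: "\<And>n. a \<le> cmod (m n)" "\<And>n. cmod (m n) \<le> b"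
    using assms unfolding SN_def by blast
  have "b > 0" using \<open>a > 0\<close> m[of 0] by linarith
  have nz: "m n \<noteq> 0" for n using m(1)[of n] \<open>a > 0\<close> by auto
  show "riesz_basis \<omega>" if "riesz_basis (\<lambda>n. m n *\<^sub>C \<omega> n)"
  proof -
    have "riesz_basis (\<lambda>n. (1 / m n) *\<^sub>C m n *\<^sub>C \<omega> n)"
      using that by (rule riesz_basis_scale[of _ "1 / b" _ "1 / a"])
        (use m \<open>a > 0\<close> \<open>b > 0\<close> nz in \<open>simp_all add: norm_divide frac_le\<close>)
    then show ?thesis using nz by (simp add: scaleC_scaleC)
  qed
  show "riesz_basis (\<lambda>n. m n *\<^sub>C \<omega> n)" if "riesz_basis \<omega>"
    using that \<open>a > 0\<close> m by (rule riesz_basis_scale)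
qed

text \<open>The two sequences differ by the factors \<open>m n / cnj (m n)\<close> of modulus 1, a
  semi-normalized symbol.\<close>

lemma riesz_basis_scale_cnj_iff:
  fixes \<psi> :: "nat \<Rightarrow> 'a"
  assumes "\<And>n. m n \<noteq> 0"
  shows "riesz_basis (\<lambda>n. cnj (m n) *\<^sub>C \<psi> n) \<longleftrightarrow> riesz_basis (\<lambda>n. m n *\<^sub>C \<psi> n)"
proof -
  have "SN (\<lambda>n. m n / cnj (m n))"
    unfolding SN_def using assms by (intro exI[of _ 1]) (simp add: norm_divide)
  from riesz_basis_scale_SN_iff[OF this, of "\<lambda>n. cnj (m n) *\<^sub>C \<psi> n"] assms
  show ?thesis by (simp add: scaleC_scaleC)
qed

text \<open>The bounded inverse of the synthesis operator sends \<open>\<omega> n\<close> to the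
  unit vector \<open>e n\<close>.\<close>

lemma riesz_basis_imp_NBB:
  fixes \<omega> :: "nat \<Rightarrow> 'a"
  assumes "riesz_basis \<omega>"
  shows "NBB \<omega>"
proof -
  obtain G where G: "bounded_clinear G" "\<And>f. G (syn \<omega> f) = f"
    using assms unfolding riesz_basis_iff cinvertible_def by blast
  obtain K where "K > 0" and K: "\<And>x. norm (G x) \<le> norm x * K"
    using G(1) bounded_linear.pos_bounded unfolding bounded_clinear_def by blast
  have "G (\<omega> n) = e n" for n using G(2)[of "e n"] by simp
  then have "1 \<le> norm (\<omega> n) * K" for n using K[of "\<omega> n"] by simp
  then show ?thesis
    unfolding NBB_iff using \<open>K > 0\<close> by (intro exI[of _ "1 / K"]) (simp add: field_simps)
qed

text \<open>The inverse of \<open>syn \<Phi>\<close> replaces \<Phi> by \<open>e\<close> without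
  losing convergence. Partial sums over an orthonormal family have computable norms, so uniform
  boundedness of these sums is literally the Bessel inequality.\<close>

lemma well_defined_left_iff:
  fixes \<Phi> \<Psi> :: "nat \<Rightarrow> 'a"
  assumes "riesz_basis \<Phi>"
  shows "multiplier_well_defined m \<Phi> \<Psi> \<longleftrightarrow> bessel (\<lambda>n. m n *\<^sub>C \<Psi> n)"
proof
  define \<omega> where "\<omega> n = cnj (m n) *\<^sub>C \<Psi> n" for n
  have bes_iff: "bessel (\<lambda>n. m n *\<^sub>C \<Psi> n) \<longleftrightarrow> bessel \<omega>"
    unfolding \<omega>_def bessel_scale_cnj_iff ..
  have wd_iff: "multiplier_well_defined m \<Phi> \<Psi> \<longleftrightarrow> (\<forall>f. summable (\<lambda>n. cinner f (\<omega> n) *\<^sub>C \<Phi> n))"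
    unfolding \<omega>_def by (rule multiplier_well_defined_alt)
  show "multiplier_well_defined m \<Phi> \<Psi>" if "bessel (\<lambda>n. m n *\<^sub>C \<Psi> n)"
    using that unfolding bes_iff wd_iff
    by (intro allI bessel_summable riesz_basis_imp_bessel[OF assms] coeff_square_summable)
  show "bessel (\<lambda>n. m n *\<^sub>C \<Psi> n)" if "multiplier_well_defined m \<Phi> \<Psi>"
    unfolding bes_iff
  proof -
    obtain G where G: "bounded_clinear G" "\<And>f. G (syn \<Phi> f) = f"
      using assms unfolding riesz_basis_iff cinvertible_def by blast
    have "G (\<Phi> n) = e n" for n using G(2)[of "e n"] by simp
    have "summable (\<lambda>n. cinner f (\<omega> n) *\<^sub>C e n)" for f
      using that bounded_linear.summable[of G "\<lambda>n. cinner f (\<omega> n) *\<^sub>C \<Phi> n"] G(1)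
      unfolding wd_iff bounded_clinear_def by (simp add: \<open>\<And>n. G (\<Phi> n) = e n\<close>)
    then obtain K where K: "\<And>N f. norm (\<Sum>n<N. cinner f (\<omega> n) *\<^sub>C e n) \<le> K * norm f"
      using partial_sums_bounded by metis
    have "(\<Sum>n<N. (cmod (cinner f (\<omega> n)))\<^sup>2) \<le> K\<^sup>2 * (norm f)\<^sup>2" for f N
      unfolding norm_sum_basis[OF finite_lessThan, symmetric] power_mult_distrib[symmetric]
      by (intro power_mono K) simp
    then show "bessel \<omega>" by (rule besselI)
  qed
qed

text \<open>Since \<open>ana \<Phi>\<close> is onto, every square-summable sequence occurs as
  coefficients of some f. Uniform boundedness, applied to finitely supported coefficients, is then a
  synthesis bound for m \<Psi>.\<close>

lemma well_defined_right_iff: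
  fixes \<Phi> \<Psi> :: "nat \<Rightarrow> 'a"
  assumes "riesz_basis \<Phi>"
  shows "multiplier_well_defined m \<Psi> \<Phi> \<longleftrightarrow> bessel (\<lambda>n. m n *\<^sub>C \<Psi> n)"
proof
  have bes: "bessel \<Phi>" by (rule riesz_basis_imp_bessel[OF assms])
  show "multiplier_well_defined m \<Psi> \<Phi>" if "bessel (\<lambda>n. m n *\<^sub>C \<Psi> n)"
    unfolding multiplier_well_defined_alt(2)
    by (intro allI bessel_summable that coeff_square_summable bes)
  assume wd: "multiplier_well_defined m \<Psi> \<Phi>"
  obtain G where G: "\<And>f. ana \<Phi> (G f) = f"
    using assms unfolding riesz_basis_iff
    by (auto simp: cinvertible_syn_iff_ana) (auto simp: cinvertible_def)
  have "summable (\<lambda>n. cinner g (e n) *\<^sub>C (m n *\<^sub>C \<Psi> n))" for g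
    using wd[unfolded multiplier_well_defined_alt(2), rule_format, of "G g"]
      cinner_ana[OF bes, of "G g"] by (simp add: G)
  then obtain K where K: "\<And>N f. norm (\<Sum>n<N. cinner f (e n) *\<^sub>C (m n *\<^sub>C \<Psi> n)) \<le> K * norm f"
    using partial_sums_bounded by metis
  show "bessel (\<lambda>n. m n *\<^sub>C \<Psi> n)"
  proof (rule synthesis_bound_imp_bessel)
    fix c :: "nat \<Rightarrow> complex" and N
    \<comment> \<open>The vector whose coefficients are c cut off at N.\<close>
    define g where "g = (\<Sum>k<N. c k *\<^sub>C e k)"
    have "cinner g (e n) = (\<Sum>k<N. if k = n then c k else 0)" for n
      unfolding g_def cinner.sum_left
      by (rule sum.cong) (auto simp: cinner_scaleC_left orthonormal)
    then have "(\<Sum>n<N. c n *\<^sub>C m n *\<^sub>C \<Psi> n) = (\<Sum>n<N. cinner g (e n) *\<^sub>C m n *\<^sub>C \<Psi> n)"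
      by (intro sum.cong) auto
    then have "(norm (\<Sum>n<N. c n *\<^sub>C m n *\<^sub>C \<Psi> n))\<^sup>2 \<le> (K * norm g)\<^sup>2"
      using K[where N = N and f = g] by (simp add: power_mono)
    then show "(norm (\<Sum>n<N. c n *\<^sub>C m n *\<^sub>C \<Psi> n))\<^sup>2 \<le> K\<^sup>2 * (\<Sum>n<N. (cmod (c n))\<^sup>2)"
      by (simp add: power_mult_distrib g_def norm_sum_basis)
  qed
qed

text \<open>The multiplier is \<open>syn \<Phi>\<close> after the analysis operator of cnj(m)
  \<Psi>. Removing the invertible first factor leaves an analysis operator, and passing to its
  adjoint gives the Riesz basis criterion.\<close>

lemma invertible_left_iff:
  fixes \<Phi> \<Psi> :: "nat \<Rightarrow> 'a"
  assumes \<Phi>: "riesz_basis \<Phi>" and "\<And>n. m n \<noteq> 0"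
  shows "multiplier_invertible m \<Phi> \<Psi> \<longleftrightarrow> riesz_basis (\<lambda>n. m n *\<^sub>C \<Psi> n)"
proof (cases "bessel (\<lambda>n. cnj (m n) *\<^sub>C \<Psi> n)")
  case True
  have "multiplier m \<Phi> \<Psi> = (\<lambda>f. syn \<Phi> (ana (\<lambda>n. cnj (m n) *\<^sub>C \<Psi> n) f))"
    by (simp add: fun_eq_iff multiplier_alt(1) syn_def cinner_ana[OF True])
  moreover have syn: "cinvertible (syn \<Phi>)" "bounded_clinear (syn \<Phi>)"
    using \<Phi> by (auto simp: riesz_basis_iff bounded_clinear_syn)
  moreover have ana: "bounded_clinear (ana (\<lambda>n. cnj (m n) *\<^sub>C \<Psi> n))"
    by (rule bounded_clinear_ana[OF True])
  ultimately have "multiplier_invertible m \<Phi> \<Psi> \<longleftrightarrow> multiplier_well_defined m \<Phi> \<Psi> \<and>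
      cinvertible (\<lambda>f. syn \<Phi> (ana (\<lambda>n. cnj (m n) *\<^sub>C \<Psi> n) f))"
    by (simp add: multiplier_invertible_def cinvertible_def bounded_clinear_compose)
  also have "\<dots> \<longleftrightarrow> cinvertible (ana (\<lambda>n. cnj (m n) *\<^sub>C \<Psi> n))"
    using True by (simp add: cinvertible_compose_left_iff[OF syn(1) ana] well_defined_left_iff[OF \<Phi>]
      bessel_scale_cnj_iff)
  also have "\<dots> \<longleftrightarrow> riesz_basis (\<lambda>n. cnj (m n) *\<^sub>C \<Psi> n)"
    using True by (simp add: riesz_basis_iff cinvertible_syn_iff_ana)
  also have "\<dots> \<longleftrightarrow> riesz_basis (\<lambda>n. m n *\<^sub>C \<Psi> n)"
    by (rule riesz_basis_scale_cnj_iff[OF assms(2)])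
  finally show ?thesis .
next
  case False
  then show ?thesis
    unfolding bessel_scale_cnj_iff
    by (auto simp: multiplier_invertible_def well_defined_left_iff[OF \<Phi>] riesz_basis_iff)
qed

text \<open>Here the multiplier is the synthesis operator of m \<Psi> after the invertible operator
  \<open>ana \<Phi>\<close>.\<close>

lemma invertible_right_iff:
  fixes \<Phi> \<Psi> :: "nat \<Rightarrow> 'a"
  assumes \<Phi>: "riesz_basis \<Phi>"
  shows "multiplier_invertible m \<Psi> \<Phi> \<longleftrightarrow> riesz_basis (\<lambda>n. m n *\<^sub>C \<Psi> n)"
proof (cases "bessel (\<lambda>n. m n *\<^sub>C \<Psi> n)")
  case True
  have bes: "bessel \<Phi>" by (rule riesz_basis_imp_bessel[OF assms])
  have "multiplier m \<Psi> \<Phi> = (\<lambda>f. syn (\<lambda>n. m n *\<^sub>C \<Psi> n) (ana \<Phi> f))"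
    by (simp add: fun_eq_iff multiplier_alt(2) syn_def cinner_ana[OF bes])
  moreover have ana: "cinvertible (ana \<Phi>)" "bounded_clinear (ana \<Phi>)"
    using \<Phi> bes by (auto simp: riesz_basis_iff cinvertible_syn_iff_ana bounded_clinear_ana)
  moreover have syn: "bounded_clinear (syn (\<lambda>n. m n *\<^sub>C \<Psi> n))"
    by (rule bounded_clinear_syn[OF True])
  ultimately have "multiplier_invertible m \<Psi> \<Phi> \<longleftrightarrow> multiplier_well_defined m \<Psi> \<Phi> \<and>
      cinvertible (\<lambda>f. syn (\<lambda>n. m n *\<^sub>C \<Psi> n) (ana \<Phi> f))"
    by (simp add: multiplier_invertible_def cinvertible_def bounded_clinear_compose)
  also have "\<dots> \<longleftrightarrow> riesz_basis (\<lambda>n. m n *\<^sub>C \<Psi> n)"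
    using True by (simp add: cinvertible_compose_right_iff[OF ana(1) syn]
      well_defined_right_iff[OF \<Phi>] riesz_basis_iff)
  finally show ?thesis .
next
  case False
  then show ?thesis
    by (auto simp: multiplier_invertible_def well_defined_right_iff[OF \<Phi>] riesz_basis_iff)
qed

text \<open>With \<open>V = syn \<Phi>\<close> the frame operator is \<open>V V*\<close>, so the canonical dual is \<open>(V*)\<^sup>-\<^sup>1 e\<close>.\<close>

lemma ana_canonical_dual:
  fixes \<Phi> :: "nat \<Rightarrow> 'a"
  assumes "riesz_basis \<Phi>"
  shows "ana \<Phi> (canonical_dual \<Phi> n) = e n"
proof -
  have bes: "bessel \<Phi>" by (rule riesz_basis_imp_bessel[OF assms])
  have frame_op: "frame_operator \<Phi> = (\<lambda>h. syn \<Phi> (ana \<Phi> h))"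
    by (simp add: fun_eq_iff frame_operator_def syn_def cinner_ana[OF bes])
  have inv: "cinvertible (syn \<Phi>)" using assms by (simp add: riesz_basis_iff)
  then have "cinvertible (frame_operator \<Phi>)"
    unfolding frame_op using cinvertible_syn_iff_ana[OF bes] by (simp add: inv cinvertible_compose[OF inv])
  then have "surj (frame_operator \<Phi>)" unfolding cinvertible_def by (metis surjI)
  then have "syn \<Phi> (ana \<Phi> (canonical_dual \<Phi> n)) = syn \<Phi> (e n)"
    using surj_f_inv_f[of "frame_operator \<Phi>" "\<Phi> n"] by (simp add: canonical_dual_def frame_op)
  then show ?thesis using inv unfolding cinvertible_def by metis
qed

lemma canonical_dual_biorthogonal:
  fixes \<Phi> :: "nat \<Rightarrow> 'a"
  assumes "riesz_basis \<Phi>"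
  shows "cinner (canonical_dual \<Phi> n) (\<Phi> k) = of_bool (n = k)"
    and "cinner (\<Phi> k) (canonical_dual \<Phi> n) = of_bool (n = k)"
proof -
  show *: "cinner (canonical_dual \<Phi> n) (\<Phi> k) = of_bool (n = k)"
    using cinner_ana[OF riesz_basis_imp_bessel[OF assms], of "canonical_dual \<Phi> n" k]
    by (simp add: ana_canonical_dual[OF assms] orthonormal)
  show "cinner (\<Phi> k) (canonical_dual \<Phi> n) = of_bool (n = k)"
    by (subst cinner_commute) (simp add: *)
qed

text \<open>Pull the orthonormal expansion of \<open>ana \<Phi> g\<close> back through the inverse
  of \<open>ana \<Phi>\<close>, which sends \<open>e n\<close> to the dual vector.\<close>

lemma canonical_dual_expansion:
  fixes \<Phi> :: "nat \<Rightarrow> 'a"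
  assumes "riesz_basis \<Phi>"
  shows "(\<lambda>n. cinner g (\<Phi> n) *\<^sub>C canonical_dual \<Phi> n) sums g"
proof -
  have bes: "bessel \<Phi>" by (rule riesz_basis_imp_bessel[OF assms])
  obtain G where G: "bounded_clinear G" "\<And>f. G (ana \<Phi> f) = f"
    using assms cinvertible_syn_iff_ana[OF bes] unfolding riesz_basis_iff cinvertible_def by auto
  have "G (c *\<^sub>C e n) = c *\<^sub>C canonical_dual \<Phi> n" for c n
    using G(1) G(2)[of "canonical_dual \<Phi> n"]
    by (simp add: ana_canonical_dual[OF assms] bounded_clinear_def)
  moreover have "(\<lambda>n. G (cinner (ana \<Phi> g) (e n) *\<^sub>C e n)) sums G (ana \<Phi> g)"
    using G(1) bounded_linear.sums[OF _ expansion, of G] unfolding bounded_clinear_def by blast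
  ultimately show ?thesis by (simp add: G cinner_ana[OF bes])
qed

text \<open>Pairing the image of g with the dual of \<Phi> reads off
  \<open>m n * cinner g (\<Psi> n)\<close>; division by \<open>m n\<close> and synthesis with the
  dual of \<Psi> restore g. The hypotheses on \<Phi> and \<Psi> are symmetric, so the statement also
  covers the multiplier with the two exchanged.\<close>

lemma multiplier_inverse:
  fixes \<Phi> \<Psi> :: "nat \<Rightarrow> 'a"
  assumes \<Phi>: "riesz_basis \<Phi>" and \<Psi>: "riesz_basis \<Psi>" and m: "\<And>n. m n \<noteq> 0"
    and inv: "multiplier_invertible m \<Phi> \<Psi>"
  shows "multiplier_well_defined (\<lambda>n. 1 / m n) (canonical_dual \<Psi>) (canonical_dual \<Phi>)"
    and "inv (multiplier m \<Phi> \<Psi>) = multiplier (\<lambda>n. 1 / m n) (canonical_dual \<Psi>) (canonical_dual \<Phi>)"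
proof -
  have "cinner (multiplier m \<Phi> \<Psi> g) (canonical_dual \<Phi> n) = m n * cinner g (\<Psi> n)" for g n
  proof -
    have "(\<lambda>k. (m k * cinner g (\<Psi> k)) *\<^sub>C \<Phi> k) sums multiplier m \<Phi> \<Psi> g"
      using inv unfolding multiplier_invertible_def multiplier_well_defined_def multiplier_def
      by (simp add: summable_sums)
    then have "(\<lambda>k. cinner ((m k * cinner g (\<Psi> k)) *\<^sub>C \<Phi> k) (canonical_dual \<Phi> n)) sums
        cinner (multiplier m \<Phi> \<Psi> g) (canonical_dual \<Phi> n)"
      by (rule cinner_sums_left)
    moreover have "(\<lambda>k. cinner ((m k * cinner g (\<Psi> k)) *\<^sub>C \<Phi> k) (canonical_dual \<Phi> n)) =
        (\<lambda>k. if k = n then m k * cinner g (\<Psi> k) else 0)"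
      by (auto simp: cinner_scaleC_left canonical_dual_biorthogonal(2)[OF \<Phi>])
    ultimately show ?thesis
      using sums_single[of n "\<lambda>k. m k * cinner g (\<Psi> k)"] by (simp add: sums_iff)
  qed
  then have sums: "(\<lambda>n. (1 / m n * cinner (multiplier m \<Phi> \<Psi> g) (canonical_dual \<Phi> n)) *\<^sub>C
      canonical_dual \<Psi> n) sums g" for g
    using canonical_dual_expansion[OF \<Psi>, of g] by (simp add: m)
  obtain G where G: "\<And>f. multiplier m \<Phi> \<Psi> (G f) = f"
    using inv unfolding multiplier_invertible_def by blast
  \<comment> \<open>Every vector is the image of \<open>G\<close> of itself under the multiplier, so
    the series for the inverse converges everywhere.\<close>
  show "multiplier_well_defined (\<lambda>n. 1 / m n) (canonical_dual \<Psi>) (canonical_dual \<Phi>)"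
    unfolding multiplier_well_defined_def using sums[of "G _"] by (simp add: G sums_iff)
  show "inv (multiplier m \<Phi> \<Psi>) = multiplier (\<lambda>n. 1 / m n) (canonical_dual \<Psi>) (canonical_dual \<Phi>)"
  proof (rule surj_imp_inv_eq)
    show "surj (multiplier m \<Phi> \<Psi>)" using G by (metis surjI)
    show "multiplier (\<lambda>n. 1 / m n) (canonical_dual \<Psi>) (canonical_dual \<Phi>) (multiplier m \<Phi> \<Psi> g) = g" for g
      using sums[of g] by (simp add: multiplier_def[of "\<lambda>n. 1 / m n"] sums_iff)
  qed
qed

text \<open>Test the lower frame bound of \<open>\<Psi>\<close> on the canonical dual of \<open>m \<Psi>\<close>.\<close>

lemma frame_scaled_riesz_imp_bounded:
  fixes \<Psi> :: "nat \<Rightarrow> 'a"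
  assumes "frame \<Psi>" and m: "\<And>n. m n \<noteq> 0" and riesz: "riesz_basis (\<lambda>n. m n *\<^sub>C \<Psi> n)"
  shows "m \<in> ell_infty"
proof -
  define \<delta> where "\<delta> = canonical_dual (\<lambda>n. m n *\<^sub>C \<Psi> n)"
  obtain A where "A > 0" and A: "\<And>h. A * (norm h)\<^sup>2 \<le> (\<Sum>n. (cmod (cinner h (\<Psi> n)))\<^sup>2)"
    using assms(1) unfolding frame_def by blast
  obtain C where "C > 0" and C: "\<And>n. norm (m n *\<^sub>C \<Psi> n) \<le> C"
    using bessel_norm_bounded[OF riesz_basis_imp_bessel[OF riesz]] by blast
  have "(cmod (m k))\<^sup>2 \<le> C\<^sup>2 / A" for k
  proof -
    have biorth: "cinner (\<delta> k) (m n *\<^sub>C \<Psi> n) = of_bool (k = n)" for n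
      unfolding \<delta>_def by (rule canonical_dual_biorthogonal[OF riesz])
    have "(cmod (cinner (\<delta> k) (\<Psi> n)))\<^sup>2 = (if n = k then 1 / (cmod (m k))\<^sup>2 else 0)" for n
    proof -
      have "cmod (m n) * cmod (cinner (\<delta> k) (\<Psi> n)) = of_bool (k = n)"
        using arg_cong[OF biorth[of n], of cmod]
        by (simp add: cinner_scaleC_right norm_mult split: if_splits)
      then have "cmod (cinner (\<delta> k) (\<Psi> n)) = of_bool (k = n) / cmod (m n)"
        using m[of n] by (simp add: field_simps)
      then show ?thesis by (simp add: power_divide)
    qed
    \<comment> \<open>By biorthogonality the frame sum at \<open>\<delta> k\<close> has a single
      nonzero term, at index k.\<close>
    then have "A * (norm (\<delta> k))\<^sup>2 \<le> 1 / (cmod (m k))\<^sup>2"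
      using A[of "\<delta> k"] sums_single[of k "\<lambda>_. 1 / (cmod (m k))\<^sup>2"] by (simp add: sums_iff)
    then have "(cmod (m k))\<^sup>2 * A * (norm (\<delta> k))\<^sup>2 \<le> 1"
      using m[of k] by (simp add: field_simps)
    \<comment> \<open>Cauchy-Schwarz on <\<open>\<delta> k\<close>,
      \<open>m k *\<^sub>C \<Psi> k\<close>> = 1 keeps \<open>\<delta> k\<close> away from zero.
      Against the upper bound just found, this caps \<open>m k\<close>.\<close>
    moreover have "1 \<le> norm (\<delta> k) * C"
      using norm_cinner_le[of "\<delta> k" "m k *\<^sub>C \<Psi> k"] C[of k]
      by (simp add: biorth) (meson mult_left_mono norm_ge_zero order_trans)
    then have "1 \<le> (norm (\<delta> k))\<^sup>2 * C\<^sup>2"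
      by (metis one_le_power power_mult_distrib)
    then have "(cmod (m k))\<^sup>2 * A * 1 \<le> (cmod (m k))\<^sup>2 * A * ((norm (\<delta> k))\<^sup>2 * C\<^sup>2)"
      using \<open>A > 0\<close> by (intro mult_left_mono) auto
    moreover have "(cmod (m k))\<^sup>2 * A * (norm (\<delta> k))\<^sup>2 * C\<^sup>2 \<le> 1 * C\<^sup>2"
      using calculation(1) by (intro mult_right_mono) auto
    ultimately have "(cmod (m k))\<^sup>2 * A \<le> C\<^sup>2" by (simp add: mult.assoc)
    then show ?thesis using \<open>A > 0\<close> by (simp add: field_simps)
  qed
  then have "cmod (m k) \<le> sqrt (C\<^sup>2 / A)" for k by (rule real_le_rsqrt)
  then show ?thesis unfolding ell_infty_def bounded_iff by blast
qed

end

section \<open>Symbols and sequences for the examples\<close>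

text \<open>Exponent \<open>a\<close> rules the even and \<open>b\<close> the odd indices, so that every combination of
  (non-)\<open>NBA\<close> and (non-)\<open>NBB\<close> is read off from the signs of \<open>a\<close> and \<open>b\<close>, and products add exponents.\<close>

definition alternating_power :: "int \<Rightarrow> int \<Rightarrow> nat \<Rightarrow> complex" where
  "alternating_power a b n = of_nat (Suc n) powi (if even n then a else b)"

lemma alternating_power_nonzero [simp]: "alternating_power a b n \<noteq> 0"
  by (simp add: alternating_power_def del: of_nat_Suc)

lemma alternating_power_mult:
  "alternating_power a b n * alternating_power c d n = alternating_power (a + c) (b + d) n"
  by (simp add: alternating_power_def power_int_add del: of_nat_Suc)

lemma alternating_power_0 [simp]: "alternating_power 0 0 n = 1"
  by (simp add: alternating_power_def)

lemma norm_alternating_power: "cmod (alternating_power a b n) = real (Suc n) powi (if even n then a else b)"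
  by (simp add: alternating_power_def norm_power_int del: of_nat_Suc)

lemma norm_alternating_power_le:
  assumes "a \<le> 0" "b \<le> 0"
  shows "cmod (alternating_power a b n) \<le> 1"
proof -
  have "real (Suc n) powi k \<le> 1" if "k \<le> 0" for k
    using power_int_increasing[of k 0 "real (Suc n)"] that by simp
  then show ?thesis using assms by (simp add: norm_alternating_power del: of_nat_Suc)
qed

lemma norm_alternating_power_ge:
  assumes "a \<ge> 0" "b \<ge> 0"
  shows "1 \<le> cmod (alternating_power a b n)"
proof -
  have "1 \<le> real (Suc n) powi k" if "k \<ge> 0" for k
    using power_int_increasing[of 0 k "real (Suc n)"] that by simp
  then show ?thesis using assms by (simp add: norm_alternating_power del: of_nat_Suc)
qed

lemma alternating_power_unbounded:
  assumes "a > 0 \<or> b > 0"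
  shows "\<exists>n. cmod (alternating_power a b n) > C"
proof -
  obtain k :: nat where k: "C < real k" using reals_Archimedean2 by blast
  have *: "C < real (Suc n) powi c" if "c > 0" "n \<ge> k" for c n
    using power_int_increasing[of 1 c "real (Suc n)"] that k by simp
  show ?thesis
  \<comment> \<open>The witnesses 2k and 2k + 1 are at least k and have the parity at which the
    positive exponent acts.\<close>
  proof (cases "a > 0")
    case True
    then show ?thesis
      using *[of a "2 * k"] by (intro exI[of _ "2 * k"]) (simp add: norm_alternating_power del: of_nat_Suc)
  next
    case False
    then show ?thesis
      using assms *[of b "2 * k + 1"]
      by (intro exI[of _ "2 * k + 1"]) (simp add: norm_alternating_power del: of_nat_Suc)
  qed
qed

lemma alternating_power_inverse: "alternating_power (- a) (- b) n = inverse (alternating_power a b n)"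
  by (simp add: alternating_power_def power_int_minus del: of_nat_Suc)

lemma alternating_power_not_bounded_below:
  assumes "a < 0 \<or> b < 0" "\<epsilon> > 0"
  shows "\<exists>n. cmod (alternating_power a b n) < \<epsilon>"
proof -
  obtain n where "cmod (alternating_power (- a) (- b) n) > 1 / \<epsilon>"
    using alternating_power_unbounded[of "- a" "- b" "1 / \<epsilon>"] assms(1) by auto
  then have "1 / \<epsilon> < 1 / cmod (alternating_power a b n)"
    by (simp add: alternating_power_inverse norm_inverse divide_inverse)
  then have "cmod (alternating_power a b n) < \<epsilon>"
    using assms(2) by (simp add: field_simps)
  then show ?thesis ..
qed

lemma NBA_alternating_power_iff:
  assumes "\<And>n. norm (x n) = cmod (alternating_power a b n)"
  shows "NBA x \<longleftrightarrow> a \<le> 0 \<and> b \<le> 0"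
  unfolding NBA_def bdd_above_def using norm_alternating_power_le[of a b]
    alternating_power_unbounded[of a b] by (auto simp: assms not_le) (meson not_le)+

lemma NBB_alternating_power_iff:
  assumes "\<And>n. norm (x n) = cmod (alternating_power a b n)"
  shows "NBB x \<longleftrightarrow> a \<ge> 0 \<and> b \<ge> 0"
proof
  show "a \<ge> 0 \<and> b \<ge> 0" if "NBB x"
    using that alternating_power_not_bounded_below[of a b] unfolding NBB_iff assms
    by (meson not_le)
  show "NBB x" if "a \<ge> 0 \<and> b \<ge> 0"
    unfolding NBB_iff assms using norm_alternating_power_ge[of a b] that
    by (intro exI[of _ 1]) simp
qed

lemma alternating_power_ell_infty_iff: "alternating_power a b \<in> ell_infty \<longleftrightarrow> a \<le> 0 \<and> b \<le> 0"
  using NBA_alternating_power_iff[of "alternating_power a b" a b]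
  by (simp add: ell_infty_iff NBA_iff)

section \<open>Three families of example sequences\<close>

context orthonormal_basis
begin

definition diag :: "int \<Rightarrow> int \<Rightarrow> nat \<Rightarrow> 'a" where
  "diag a b n = alternating_power a b n *\<^sub>C e n"

text \<open>With exponent 0 on the even indices this contains the whole basis and stays a frame
  while the odd copies decay.\<close>

definition doubled :: "int \<Rightarrow> int \<Rightarrow> nat \<Rightarrow> 'a" where
  "doubled a b n = alternating_power a b n *\<^sub>C e (n div 2)"

text \<open>All vectors point in one direction, so bounded norms do not make it Bessel.\<close>

definition repeated :: "int \<Rightarrow> int \<Rightarrow> nat \<Rightarrow> 'a" where
  "repeated a b n = alternating_power a b n *\<^sub>C e 0"

lemmas family_defs = diag_def doubled_def repeated_def

lemma basis_nonzero [simp]: "e n \<noteq> 0"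
  using norm_basis[of n] by force

lemma norm_family:
  "norm (diag a b n) = cmod (alternating_power a b n)"
  "norm (doubled a b n) = cmod (alternating_power a b n)"
  "norm (repeated a b n) = cmod (alternating_power a b n)"
  by (simp_all add: family_defs norm_scaleC)

lemma scale_family:
  "alternating_power c d n *\<^sub>C diag a b n = diag (c + a) (d + b) n"
  "alternating_power c d n *\<^sub>C doubled a b n = doubled (c + a) (d + b) n"
  "alternating_power c d n *\<^sub>C repeated a b n = repeated (c + a) (d + b) n"
  by (simp_all add: family_defs scaleC_scaleC alternating_power_mult)

lemmas NBB_family = norm_family[THEN NBB_alternating_power_iff]
lemmas NBA_family = norm_family[THEN NBA_alternating_power_iff]

lemma bessel_imp_NBA_family:
  assumes "bessel x" "\<And>n. norm (x n) = cmod (alternating_power a b n)"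
  shows "a \<le> 0 \<and> b \<le> 0"
  using bessel_imp_NBA[OF assms(1)] NBA_alternating_power_iff[OF assms(2)] by blast

lemma bessel_diag_iff: "bessel (diag a b) \<longleftrightarrow> a \<le> 0 \<and> b \<le> 0"
proof
  show "a \<le> 0 \<and> b \<le> 0" if "bessel (diag a b)"
    using that norm_family(1) by (rule bessel_imp_NBA_family)
  show "bessel (diag a b)" if "a \<le> 0 \<and> b \<le> 0"
    unfolding diag_def[abs_def]
    by (rule bessel_scale[OF bessel_basis norm_alternating_power_le]) (use that in auto)
qed

lemma riesz_basis_diag_iff: "riesz_basis (diag a b) \<longleftrightarrow> a = 0 \<and> b = 0"
proof
  assume *: "riesz_basis (diag a b)"
  have "NBB (diag a b)" by (rule riesz_basis_imp_NBB[OF *])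
  moreover have "bessel (diag a b)" by (rule riesz_basis_imp_bessel[OF *])
  ultimately show "a = 0 \<and> b = 0" by (auto simp: NBB_family bessel_diag_iff)
next
  assume "a = 0 \<and> b = 0"
  then show "riesz_basis (diag a b)"
    using riesz_basis_basis by (simp add: diag_def[abs_def])
qed

text \<open>At \<open>e k\<close> the frame sum reduces to the squared norm of the k-th member, so
  the lower frame bound is a lower bound for the norms.\<close>

lemma frame_diag_imp:
  assumes "frame (diag a b)"
  shows "a \<ge> 0 \<and> b \<ge> 0"
proof -
  obtain A where "A > 0" and A: "\<And>h. A * (norm h)\<^sup>2 \<le> (\<Sum>n. (cmod (cinner h (diag a b n)))\<^sup>2)"
    using assms unfolding frame_def by blast
  have "sqrt A \<le> norm (diag a b k)" for k
  proof -
    have "(\<lambda>n. (cmod (cinner (e k) (diag a b n)))\<^sup>2) =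
        (\<lambda>n. if n = k then (norm (diag a b n))\<^sup>2 else 0)"
      by (auto simp: diag_def cinner_scaleC_right orthonormal norm_mult norm_scaleC)
    then have "A \<le> (norm (diag a b k))\<^sup>2"
      using A[of "e k"] sums_single[of k "\<lambda>n. (norm (diag a b n))\<^sup>2"] by (simp add: sums_iff)
    then show ?thesis using real_sqrt_le_mono by fastforce
  qed
  then have "NBB (diag a b)" unfolding NBB_iff using \<open>A > 0\<close> by (intro exI[of _ "sqrt A"]) simp
  then show ?thesis by (simp add: NBB_family)
qed

lemma not_frame_diag: "a < 0 \<Longrightarrow> \<not> frame (diag a b)"
  using frame_diag_imp by force

lemma sum_doubled: "(\<Sum>n<2 * N. f n) = (\<Sum>k<N. f (2 * k) + f (Suc (2 * k)))"
  for f :: "nat \<Rightarrow> real"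
  by (induction N) (simp_all add: add.assoc)

lemma bessel_doubled_iff: "bessel (doubled a b) \<longleftrightarrow> a \<le> 0 \<and> b \<le> 0"
proof
  show "a \<le> 0 \<and> b \<le> 0" if "bessel (doubled a b)"
    using that norm_family(2) by (rule bessel_imp_NBA_family)
  \<comment> \<open>The constant 2 counts the two occurrences of each basis vector; 2N terms give
    complete pairs and cover the first N terms.\<close>
  have "(\<Sum>n<N. (cmod (cinner h (e (n div 2))))\<^sup>2) \<le> 2 * (norm h)\<^sup>2" for h N
  proof -
    have "(\<Sum>n<N. (cmod (cinner h (e (n div 2))))\<^sup>2) \<le> (\<Sum>n<2 * N. (cmod (cinner h (e (n div 2))))\<^sup>2)"
      by (intro sum_mono2) auto
    also have "\<dots> = 2 * (\<Sum>k<N. (cmod (cinner h (e k)))\<^sup>2)"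
      by (simp add: sum_doubled sum_distrib_left)
    also have "\<dots> \<le> 2 * (norm h)\<^sup>2"
      using parseval[of h] sum_le_suminf[of "\<lambda>k. (cmod (cinner h (e k)))\<^sup>2" "{..<N}"]
      by (simp add: sums_iff)
    finally show ?thesis .
  qed
  then have "bessel (\<lambda>n. e (n div 2))" by (rule besselI)
  then show "bessel (doubled a b)" if "a \<le> 0 \<and> b \<le> 0"
    unfolding doubled_def[abs_def]
    by (rule bessel_scale[OF _ norm_alternating_power_le]) (use that in auto)
qed

text \<open>The even-indexed members form the orthonormal basis itself, which already supplies the
  lower bound 1 by Parseval.\<close>

lemma frame_doubled:
  assumes "b \<le> 0"
  shows "frame (doubled 0 b)"
proof -
  have bes: "bessel (doubled 0 b)" using assms by (simp add: bessel_doubled_iff)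
  have "(norm h)\<^sup>2 \<le> (\<Sum>n. (cmod (cinner h (doubled 0 b n)))\<^sup>2)" for h
  proof -
    have "(\<Sum>k<N. (cmod (cinner h (e k)))\<^sup>2) \<le> (\<Sum>n. (cmod (cinner h (doubled 0 b n)))\<^sup>2)" for N
    proof -
      have "(\<Sum>k<N. (cmod (cinner h (e k)))\<^sup>2) \<le> (\<Sum>n<2 * N. (cmod (cinner h (doubled 0 b n)))\<^sup>2)"
        unfolding sum_doubled
        by (intro sum_mono) (simp add: doubled_def alternating_power_def)
      also have "\<dots> \<le> (\<Sum>n. (cmod (cinner h (doubled 0 b n)))\<^sup>2)"
        by (intro sum_le_suminf coeff_square_summable bes) auto
      finally show ?thesis .
    qed
    then show ?thesis
      using parseval[of h] suminf_le_const[of "\<lambda>k. (cmod (cinner h (e k)))\<^sup>2"] by (simp add: sums_iff)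
  qed
  then show ?thesis
    using bes unfolding frame_def by (intro conjI exI[of _ 1]) auto
qed

text \<open>Against \<open>e 0\<close> every even-indexed coefficient equals 1, so the squares are
  not summable.\<close>

lemma not_bessel_repeated: "\<not> bessel (repeated 0 b)"
proof
  assume "bessel (repeated 0 b)"
  then have "(\<lambda>n. (cmod (cinner (e 0) (repeated 0 b n)))\<^sup>2) \<longlonglongrightarrow> 0"
    by (intro summable_LIMSEQ_zero coeff_square_summable)
  from LIMSEQ_subseq_LIMSEQ[OF this, of "\<lambda>k. 2 * k"]
  show False
    by (simp add: strict_mono_def repeated_def alternating_power_def cinner_scaleC_right
        orthonormal comp_def LIMSEQ_const_iff)
qed

text \<open>By Cauchy-Schwarz it suffices that the weights 1/(n + 1) are square summable; the
  constant is Euler's sum of inverse squares.\<close>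

lemma bessel_repeated: "bessel (repeated (- 1) (- 1))"
proof (rule synthesis_bound_imp_bessel)
  fix c N
  define w where "w n = alternating_power (- 1) (- 1) n" for n
  have "(norm (\<Sum>n<N. c n *\<^sub>C repeated (- 1) (- 1) n))\<^sup>2 = (cmod (\<Sum>n<N. c n * w n))\<^sup>2"
    by (simp add: repeated_def w_def scaleC_scaleC norm_scaleC flip: scaleC.sum_left)
  also have "\<dots> \<le> (\<Sum>n<N. cmod (c n) * cmod (w n))\<^sup>2"
    by (intro power_mono order_trans[OF norm_sum]) (auto simp: norm_mult)
  also have "\<dots> \<le> (\<Sum>n<N. (cmod (c n))\<^sup>2) * (\<Sum>n<N. (cmod (w n))\<^sup>2)"
    by (rule Cauchy_Schwarz_ineq_sum)
  also have "\<dots> \<le> (\<Sum>n<N. (cmod (c n))\<^sup>2) * (pi\<^sup>2 / 6)"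
  proof (intro mult_left_mono sum_nonneg)
    have "(cmod (w n))\<^sup>2 = 1 / (1 + real n)\<^sup>2" for n
      by (simp add: w_def norm_alternating_power power_int_minus power_inverse divide_inverse)
    then show "(\<Sum>n<N. (cmod (w n))\<^sup>2) \<le> pi\<^sup>2 / 6"
      using inverse_squares_sums sum_le_suminf[of "\<lambda>n. 1 / (1 + real n)\<^sup>2" "{..<N}"]
      by (simp add: sums_iff add.commute[of _ 1])
  qed auto
  finally show "(norm (\<Sum>n<N. c n *\<^sub>C repeated (- 1) (- 1) n))\<^sup>2 \<le> (pi\<^sup>2 / 6) * (\<Sum>n<N. (cmod (c n))\<^sup>2)"
    by (simp add: mult.commute)
qed

lemma admissible_well_defined_iff:
  fixes \<Phi> \<Psi> :: "nat \<Rightarrow> 'a"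
  assumes "admissible \<Phi> \<Psi> m"
  shows "multiplier_well_defined m \<Phi> \<Psi> \<longleftrightarrow> bessel (\<lambda>n. m n *\<^sub>C \<Psi> n)"
    and "multiplier_well_defined m \<Psi> \<Phi> \<longleftrightarrow> bessel (\<lambda>n. m n *\<^sub>C \<Psi> n)"
  using assms well_defined_left_iff well_defined_right_iff unfolding admissible_def by blast+

lemma admissible_invertible_iff:
  fixes \<Phi> \<Psi> :: "nat \<Rightarrow> 'a"
  assumes "admissible \<Phi> \<Psi> m"
  shows "multiplier_invertible m \<Phi> \<Psi> \<longleftrightarrow> riesz_basis (\<lambda>n. m n *\<^sub>C \<Psi> n)"
    and "multiplier_invertible m \<Psi> \<Phi> \<longleftrightarrow> riesz_basis (\<lambda>n. m n *\<^sub>C \<Psi> n)"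
  using assms invertible_left_iff invertible_right_iff unfolding admissible_def by blast+

lemma not_invertible:
  fixes \<Phi> \<Psi> :: "nat \<Rightarrow> 'a"
  assumes "admissible \<Phi> \<Psi> m" "\<not> NBB (\<lambda>n. m n *\<^sub>C \<Psi> n)"
  shows "\<not> multiplier_invertible m \<Phi> \<Psi> \<and> \<not> multiplier_invertible m \<Psi> \<Phi>"
  unfolding admissible_invertible_iff[OF assms(1)] using assms(2) riesz_basis_imp_NBB by blast

lemma admissible_family:
  "admissible e (diag a b) (alternating_power c d)"
  "admissible e (doubled a b) (alternating_power c d)"
  "admissible e (repeated a b) (alternating_power c d)"
  by (simp_all add: admissible_def riesz_basis_basis family_defs)

text \<open>For a concrete triple these rules move the symbol into the sequence and turn most claims
  into sign conditions on integer exponents.\<close>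

lemmas example_simps = admissible_family
  admissible_family[THEN admissible_well_defined_iff(1)]
  admissible_family[THEN admissible_well_defined_iff(2)]
  admissible_family[THEN admissible_invertible_iff(1)]
  admissible_family[THEN admissible_invertible_iff(2)]
  scale_family bessel_diag_iff riesz_basis_diag_iff bessel_doubled_iff
  not_bessel_repeated bessel_repeated NBA_family NBB_family
  alternating_power_ell_infty_iff NBB_alternating_power_iff[OF refl]

end

section \<open>The cases of the theorem\<close>

lemma SN_imp: "SN m \<Longrightarrow> NBB m \<and> m \<in> ell_infty"
  by (auto simp: SN_def NBB_iff ell_infty_iff)

lemma bessel_scale_ell_infty: "bessel \<psi> \<Longrightarrow> m \<in> ell_infty \<Longrightarrow> bessel (\<lambda>n. m n *\<^sub>C \<psi> n)"
  unfolding ell_infty_iff by (auto intro: bessel_scale)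

lemma bessel_unscale_NBB: "bessel (\<lambda>n. m n *\<^sub>C \<psi> n) \<Longrightarrow> NBB m \<Longrightarrow> bessel \<psi>"
  unfolding NBB_iff by (auto intro: bessel_unscale)

text \<open>From a \<le> |m| |\<psi>| and |\<psi>| \<le> b one gets |m| \<ge> a/b, where b is
  positive because a is.\<close>

lemma NBB_scaleC_imp_scalar:
  fixes \<psi> :: "nat \<Rightarrow> 'a::complex_hilbert"
  assumes "NBB (\<lambda>n. m n *\<^sub>C \<psi> n)" "NBA \<psi>"
  shows "NBB m"
proof -
  obtain a where "a > 0" and a: "\<And>n. a \<le> cmod (m n) * norm (\<psi> n)"
    using assms(1) by (auto simp: NBB_iff norm_scaleC)
  obtain b where b: "\<And>n. norm (\<psi> n) \<le> b" using assms(2) by (auto simp: NBA_iff)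
  have le: "a \<le> cmod (m n) * b" for n
    by (rule order_trans[OF a mult_left_mono[OF b]]) simp
  moreover have "b \<noteq> 0" using le[of 0] \<open>a > 0\<close> by auto
  moreover have "b \<ge> 0" by (rule order_trans[OF norm_ge_zero b])
  ultimately show ?thesis
    unfolding NBB_iff using \<open>a > 0\<close> by (intro exI[of _ "a / b"]) (simp add: field_simps)
qed

lemma NBB_scaleC_imp_vector:
  fixes \<psi> :: "nat \<Rightarrow> 'a::complex_hilbert"
  assumes "NBB (\<lambda>n. m n *\<^sub>C \<psi> n)" "m \<in> ell_infty"
  shows "NBB \<psi>"
proof -
  obtain a where "a > 0" and a: "\<And>n. a \<le> cmod (m n) * norm (\<psi> n)"
    using assms(1) by (auto simp: NBB_iff norm_scaleC)
  obtain b where b: "\<And>n. cmod (m n) \<le> b" using assms(2) by (auto simp: ell_infty_iff)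
  have le: "a \<le> b * norm (\<psi> n)" for n
    by (rule order_trans[OF a mult_right_mono[OF b]]) simp
  moreover have "b \<noteq> 0" using le[of 0] \<open>a > 0\<close> by auto
  moreover have "b \<ge> 0" by (rule order_trans[OF norm_ge_zero b])
  ultimately show ?thesis
    unfolding NBB_iff using \<open>a > 0\<close> by (intro exI[of _ "a / b"]) (simp add: field_simps)
qed

lemma bessel_scale_imp_bounded:
  fixes \<psi> :: "nat \<Rightarrow> 'a::complex_hilbert"
  assumes "bessel (\<lambda>n. m n *\<^sub>C \<psi> n)" "NBB \<psi>"
  shows "m \<in> ell_infty"
proof -
  obtain a where "a > 0" and a: "\<And>n. a \<le> norm (\<psi> n)"
    using assms(2) by (auto simp: NBB_iff)
  obtain C where C: "\<And>n. cmod (m n) * norm (\<psi> n) \<le> C"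
    using bessel_norm_bounded[OF assms(1)] by (metis norm_scaleC)
  have "cmod (m n) * a \<le> C" for n
    by (rule order_trans[OF mult_left_mono[OF a] C]) simp
  then show ?thesis
    unfolding ell_infty_iff using \<open>a > 0\<close> by (intro exI[of _ "C / a"]) (simp add: field_simps)
qed

lemma ex3I: "P x y z \<Longrightarrow> \<exists>x y z. P x y z"
  by blast

section \<open>Universal statements behind the cases\<close>

context orthonormal_basis
begin

lemma SN_bessel:
  fixes \<Phi> \<Psi> :: "nat \<Rightarrow> 'a"
  assumes adm: "admissible \<Phi> \<Psi> m" and "SN m"
  shows "(multiplier_invertible m \<Phi> \<Psi> \<longleftrightarrow> riesz_basis \<Psi>)
    \<and> (multiplier_invertible m \<Psi> \<Phi> \<longleftrightarrow> riesz_basis \<Psi>)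
    \<and> (multiplier_invertible m \<Phi> \<Psi> \<longrightarrow>
        multiplier_well_defined (\<lambda>n. 1 / m n) (canonical_dual \<Psi>) (canonical_dual \<Phi>)
        \<and> inv (multiplier m \<Phi> \<Psi>) = multiplier (\<lambda>n. 1 / m n) (canonical_dual \<Psi>) (canonical_dual \<Phi>))
    \<and> (multiplier_invertible m \<Psi> \<Phi> \<longrightarrow>
        multiplier_well_defined (\<lambda>n. 1 / m n) (canonical_dual \<Phi>) (canonical_dual \<Psi>)
        \<and> inv (multiplier m \<Psi> \<Phi>) = multiplier (\<lambda>n. 1 / m n) (canonical_dual \<Phi>) (canonical_dual \<Psi>))"
proof (intro conjI impI)
  have \<Phi>: "riesz_basis \<Phi>" and m: "\<And>n. m n \<noteq> 0" using adm by (auto simp: admissible_def)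
  show left: "multiplier_invertible m \<Phi> \<Psi> \<longleftrightarrow> riesz_basis \<Psi>"
    and right: "multiplier_invertible m \<Psi> \<Phi> \<longleftrightarrow> riesz_basis \<Psi>"
    using adm \<open>SN m\<close> by (simp_all add: admissible_invertible_iff riesz_basis_scale_SN_iff)
  {
    assume inv: "multiplier_invertible m \<Phi> \<Psi>"
    then have "riesz_basis \<Psi>" using left by simp
    from multiplier_inverse[OF \<Phi> this m inv]
    show "multiplier_well_defined (\<lambda>n. 1 / m n) (canonical_dual \<Psi>) (canonical_dual \<Phi>)"
      and "inv (multiplier m \<Phi> \<Psi>) = multiplier (\<lambda>n. 1 / m n) (canonical_dual \<Psi>) (canonical_dual \<Phi>)" .
  next
    assume inv: "multiplier_invertible m \<Psi> \<Phi>"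
    then have "riesz_basis \<Psi>" using right by simp
    from multiplier_inverse[OF this \<Phi> m inv]
    show "multiplier_well_defined (\<lambda>n. 1 / m n) (canonical_dual \<Phi>) (canonical_dual \<Psi>)"
      and "inv (multiplier m \<Psi> \<Phi>) = multiplier (\<lambda>n. 1 / m n) (canonical_dual \<Phi>) (canonical_dual \<Psi>)" .
  }
qed

lemma non_NBB_symbol_NBA:
  fixes \<Phi> \<Psi> :: "nat \<Rightarrow> 'a"
  assumes "admissible \<Phi> \<Psi> m" "\<not> NBB m" "NBA \<Psi>"
  shows "\<not> multiplier_invertible m \<Phi> \<Psi> \<and> \<not> multiplier_invertible m \<Psi> \<Phi>"
  using assms by (intro not_invertible) (auto dest: NBB_scaleC_imp_scalar)

lemma bounded_symbol_non_NBB: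
  fixes \<Phi> \<Psi> :: "nat \<Rightarrow> 'a"
  assumes "admissible \<Phi> \<Psi> m" "m \<in> ell_infty" "\<not> NBB \<Psi>"
  shows "\<not> multiplier_invertible m \<Phi> \<Psi> \<and> \<not> multiplier_invertible m \<Psi> \<Phi>"
  using assms by (intro not_invertible) (auto dest: NBB_scaleC_imp_vector)

lemma bounded_symbol_bessel:
  fixes \<Phi> \<Psi> :: "nat \<Rightarrow> 'a"
  assumes "admissible \<Phi> \<Psi> m" "m \<in> ell_infty" "bessel \<Psi>"
  shows "multiplier_well_defined m \<Phi> \<Psi> \<and> multiplier_well_defined m \<Psi> \<Phi>"
  using assms by (simp add: admissible_well_defined_iff bessel_scale_ell_infty)

lemma NBB_symbol_non_bessel:
  fixes \<Phi> \<Psi> :: "nat \<Rightarrow> 'a"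
  assumes "admissible \<Phi> \<Psi> m" "NBB m" "\<not> bessel \<Psi>"
  shows "\<not> multiplier_well_defined m \<Phi> \<Psi> \<and> \<not> multiplier_well_defined m \<Psi> \<Phi>"
  using assms by (auto simp: admissible_well_defined_iff dest: bessel_unscale_NBB)

lemma unbounded_symbol_NBB:
  fixes \<Phi> \<Psi> :: "nat \<Rightarrow> 'a"
  assumes "admissible \<Phi> \<Psi> m" "m \<notin> ell_infty" "NBB \<Psi>"
  shows "\<not> multiplier_well_defined m \<Phi> \<Psi> \<and> \<not> multiplier_well_defined m \<Psi> \<Phi>"
  using assms by (auto simp: admissible_well_defined_iff dest: bessel_scale_imp_bounded)

lemma unbounded_symbol_frame:
  fixes \<Phi> \<Psi> :: "nat \<Rightarrow> 'a"
  assumes "admissible \<Phi> \<Psi> m" "m \<notin> ell_infty" "frame \<Psi>"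
  shows "\<not> multiplier_invertible m \<Phi> \<Psi> \<and> \<not> multiplier_invertible m \<Psi> \<Phi>"
  using frame_scaled_riesz_imp_bounded[OF assms(3), of m] assms(1,2)
  unfolding admissible_invertible_iff[OF assms(1)] by (auto simp: admissible_def)

end

theorem theorem4p11:
  assumes separable: "\<exists>D :: 'a::complex_hilbert set. countable D \<and> closure D = UNIV"
    and infinite_dimensional: "\<not> (\<exists>S :: 'a set. finite S \<and> cspan S = UNIV)"
  shows "
    \<comment> \<open>(a1)\<close>
      (\<forall>(\<Phi> :: nat \<Rightarrow> 'a) \<Psi> m. admissible \<Phi> \<Psi> m \<and> SN m \<and> \<not> bessel \<Psi>
        \<longrightarrow> \<not> multiplier_well_defined m \<Phi> \<Psi> \<and> \<not> multiplier_well_defined m \<Psi> \<Phi>)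
    \<comment> \<open>(a2)\<close>
    \<and> (\<forall>(\<Phi> :: nat \<Rightarrow> 'a) \<Psi> m. admissible \<Phi> \<Psi> m \<and> SN m \<and> bessel \<Psi>
        \<longrightarrow> (multiplier_invertible m \<Phi> \<Psi> \<longleftrightarrow> riesz_basis \<Psi>)
        \<and> (multiplier_invertible m \<Psi> \<Phi> \<longleftrightarrow> riesz_basis \<Psi>)
        \<and> (multiplier_invertible m \<Phi> \<Psi> \<longrightarrow> multiplier_well_defined (\<lambda>n. 1 / m n) (canonical_dual \<Psi>) (canonical_dual \<Phi>)
            \<and> inv (multiplier m \<Phi> \<Psi>) = multiplier (\<lambda>n. 1 / m n) (canonical_dual \<Psi>) (canonical_dual \<Phi>))
        \<and> (multiplier_invertible m \<Psi> \<Phi> \<longrightarrow> multiplier_well_defined (\<lambda>n. 1 / m n) (canonical_dual \<Phi>) (canonical_dual \<Psi>)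
            \<and> inv (multiplier m \<Psi> \<Phi>) = multiplier (\<lambda>n. 1 / m n) (canonical_dual \<Phi>) (canonical_dual \<Psi>)))
    \<comment> \<open>(b1)\<close>
    \<and> (\<exists>(\<Phi> :: nat \<Rightarrow> 'a) \<Psi> m. admissible \<Phi> \<Psi> m \<and> \<not> NBB m \<and> m \<in> ell_infty \<and> NBA \<Psi> \<and> \<not> bessel \<Psi>
        \<and> multiplier_well_defined m \<Phi> \<Psi>)
    \<and> (\<exists>(\<Phi> :: nat \<Rightarrow> 'a) \<Psi> m. admissible \<Phi> \<Psi> m \<and> \<not> NBB m \<and> m \<in> ell_infty \<and> NBA \<Psi> \<and> \<not> bessel \<Psi>
        \<and> \<not> multiplier_well_defined m \<Phi> \<Psi>)
    \<and> (\<exists>(\<Phi> :: nat \<Rightarrow> 'a) \<Psi> m. admissible \<Phi> \<Psi> m \<and> \<not> NBB m \<and> m \<in> ell_infty \<and> NBA \<Psi> \<and> \<not> bessel \<Psi>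
        \<and> multiplier_well_defined m \<Psi> \<Phi>)
    \<and> (\<exists>(\<Phi> :: nat \<Rightarrow> 'a) \<Psi> m. admissible \<Phi> \<Psi> m \<and> \<not> NBB m \<and> m \<in> ell_infty \<and> NBA \<Psi> \<and> \<not> bessel \<Psi>
        \<and> \<not> multiplier_well_defined m \<Psi> \<Phi>)
    \<and> (\<forall>(\<Phi> :: nat \<Rightarrow> 'a) \<Psi> m. admissible \<Phi> \<Psi> m \<and> \<not> NBB m \<and> m \<in> ell_infty \<and> NBA \<Psi> \<and> \<not> bessel \<Psi>
        \<longrightarrow> \<not> multiplier_invertible m \<Phi> \<Psi> \<and> \<not> multiplier_invertible m \<Psi> \<Phi>)
    \<comment> \<open>(b2)\<close>
    \<and> (\<exists>(\<Phi> :: nat \<Rightarrow> 'a) \<Psi> m. admissible \<Phi> \<Psi> m \<and> \<not> NBB m \<and> m \<in> ell_infty \<and> \<not> NBA \<Psi> \<and> \<not> NBB \<Psi> \<and> \<not> bessel \<Psi>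
        \<and> multiplier_well_defined m \<Phi> \<Psi>)
    \<and> (\<exists>(\<Phi> :: nat \<Rightarrow> 'a) \<Psi> m. admissible \<Phi> \<Psi> m \<and> \<not> NBB m \<and> m \<in> ell_infty \<and> \<not> NBA \<Psi> \<and> \<not> NBB \<Psi> \<and> \<not> bessel \<Psi>
        \<and> \<not> multiplier_well_defined m \<Phi> \<Psi>)
    \<and> (\<exists>(\<Phi> :: nat \<Rightarrow> 'a) \<Psi> m. admissible \<Phi> \<Psi> m \<and> \<not> NBB m \<and> m \<in> ell_infty \<and> \<not> NBA \<Psi> \<and> \<not> NBB \<Psi> \<and> \<not> bessel \<Psi>
        \<and> multiplier_well_defined m \<Psi> \<Phi>)
    \<and> (\<exists>(\<Phi> :: nat \<Rightarrow> 'a) \<Psi> m. admissible \<Phi> \<Psi> m \<and> \<not> NBB m \<and> m \<in> ell_infty \<and> \<not> NBA \<Psi> \<and> \<not> NBB \<Psi> \<and> \<not> bessel \<Psi>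
        \<and> \<not> multiplier_well_defined m \<Psi> \<Phi>)
    \<and> (\<forall>(\<Phi> :: nat \<Rightarrow> 'a) \<Psi> m. admissible \<Phi> \<Psi> m \<and> \<not> NBB m \<and> m \<in> ell_infty \<and> \<not> NBA \<Psi> \<and> \<not> NBB \<Psi> \<and> \<not> bessel \<Psi>
        \<longrightarrow> \<not> multiplier_invertible m \<Phi> \<Psi> \<and> \<not> multiplier_invertible m \<Psi> \<Phi>)
    \<comment> \<open>(b3)\<close>
    \<and> (\<exists>(\<Phi> :: nat \<Rightarrow> 'a) \<Psi> m. admissible \<Phi> \<Psi> m \<and> \<not> NBB m \<and> m \<in> ell_infty \<and> \<not> NBA \<Psi> \<and> NBB \<Psi> \<and> \<not> bessel \<Psi>
        \<and> multiplier_invertible m \<Phi> \<Psi> \<and> multiplier_invertible m \<Psi> \<Phi>)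
    \<and> (\<exists>(\<Phi> :: nat \<Rightarrow> 'a) \<Psi> m. admissible \<Phi> \<Psi> m \<and> \<not> NBB m \<and> m \<in> ell_infty \<and> \<not> NBA \<Psi> \<and> NBB \<Psi> \<and> \<not> bessel \<Psi>
        \<and> multiplier_well_defined m \<Phi> \<Psi> \<and> \<not> multiplier_invertible m \<Phi> \<Psi> \<and> multiplier_well_defined m \<Psi> \<Phi> \<and> \<not> multiplier_invertible m \<Psi> \<Phi>)
    \<and> (\<exists>(\<Phi> :: nat \<Rightarrow> 'a) \<Psi> m. admissible \<Phi> \<Psi> m \<and> \<not> NBB m \<and> m \<in> ell_infty \<and> \<not> NBA \<Psi> \<and> NBB \<Psi> \<and> \<not> bessel \<Psi>
        \<and> \<not> multiplier_well_defined m \<Phi> \<Psi> \<and> \<not> multiplier_well_defined m \<Psi> \<Phi>)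
    \<comment> \<open>(b4)\<close>
    \<and> (\<forall>(\<Phi> :: nat \<Rightarrow> 'a) \<Psi> m. admissible \<Phi> \<Psi> m \<and> \<not> NBB m \<and> m \<in> ell_infty \<and> bessel \<Psi>
        \<longrightarrow> multiplier_well_defined m \<Phi> \<Psi> \<and> \<not> multiplier_invertible m \<Phi> \<Psi> \<and> multiplier_well_defined m \<Psi> \<Phi> \<and> \<not> multiplier_invertible m \<Psi> \<Phi>)
    \<comment> \<open>(c1)\<close>
    \<and> (\<forall>(\<Phi> :: nat \<Rightarrow> 'a) \<Psi> m. admissible \<Phi> \<Psi> m \<and> NBB m \<and> m \<notin> ell_infty \<and> (\<not> bessel \<Psi> \<or> NBB \<Psi>)
        \<longrightarrow> \<not> multiplier_well_defined m \<Phi> \<Psi> \<and> \<not> multiplier_well_defined m \<Psi> \<Phi>)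
    \<comment> \<open>(c2)\<close>
    \<and> (\<exists>(\<Phi> :: nat \<Rightarrow> 'a) \<Psi> m. admissible \<Phi> \<Psi> m \<and> NBB m \<and> m \<notin> ell_infty \<and> \<not> NBB \<Psi> \<and> bessel \<Psi> \<and> \<not> frame \<Psi>
        \<and> multiplier_invertible m \<Phi> \<Psi> \<and> multiplier_invertible m \<Psi> \<Phi>)
    \<and> (\<exists>(\<Phi> :: nat \<Rightarrow> 'a) \<Psi> m. admissible \<Phi> \<Psi> m \<and> NBB m \<and> m \<notin> ell_infty \<and> \<not> NBB \<Psi> \<and> bessel \<Psi> \<and> \<not> frame \<Psi>
        \<and> multiplier_well_defined m \<Phi> \<Psi> \<and> \<not> multiplier_invertible m \<Phi> \<Psi> \<and> multiplier_well_defined m \<Psi> \<Phi> \<and> \<not> multiplier_invertible m \<Psi> \<Phi>)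
    \<and> (\<exists>(\<Phi> :: nat \<Rightarrow> 'a) \<Psi> m. admissible \<Phi> \<Psi> m \<and> NBB m \<and> m \<notin> ell_infty \<and> \<not> NBB \<Psi> \<and> bessel \<Psi> \<and> \<not> frame \<Psi>
        \<and> \<not> multiplier_well_defined m \<Phi> \<Psi> \<and> \<not> multiplier_well_defined m \<Psi> \<Phi>)
    \<comment> \<open>(c3)\<close>
    \<and> (\<exists>(\<Phi> :: nat \<Rightarrow> 'a) \<Psi> m. admissible \<Phi> \<Psi> m \<and> NBB m \<and> m \<notin> ell_infty \<and> \<not> NBB \<Psi> \<and> frame \<Psi>
        \<and> multiplier_well_defined m \<Phi> \<Psi>)
    \<and> (\<exists>(\<Phi> :: nat \<Rightarrow> 'a) \<Psi> m. admissible \<Phi> \<Psi> m \<and> NBB m \<and> m \<notin> ell_infty \<and> \<not> NBB \<Psi> \<and> frame \<Psi>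
        \<and> \<not> multiplier_well_defined m \<Phi> \<Psi>)
    \<and> (\<exists>(\<Phi> :: nat \<Rightarrow> 'a) \<Psi> m. admissible \<Phi> \<Psi> m \<and> NBB m \<and> m \<notin> ell_infty \<and> \<not> NBB \<Psi> \<and> frame \<Psi>
        \<and> multiplier_well_defined m \<Psi> \<Phi>)
    \<and> (\<exists>(\<Phi> :: nat \<Rightarrow> 'a) \<Psi> m. admissible \<Phi> \<Psi> m \<and> NBB m \<and> m \<notin> ell_infty \<and> \<not> NBB \<Psi> \<and> frame \<Psi>
        \<and> \<not> multiplier_well_defined m \<Psi> \<Phi>)
    \<and> (\<forall>(\<Phi> :: nat \<Rightarrow> 'a) \<Psi> m. admissible \<Phi> \<Psi> m \<and> NBB m \<and> m \<notin> ell_infty \<and> \<not> NBB \<Psi> \<and> frame \<Psi>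
        \<longrightarrow> \<not> multiplier_invertible m \<Phi> \<Psi> \<and> \<not> multiplier_invertible m \<Psi> \<Phi>)
    \<comment> \<open>(d1)\<close>
    \<and> (\<forall>(\<Phi> :: nat \<Rightarrow> 'a) \<Psi> m. admissible \<Phi> \<Psi> m \<and> \<not> NBB m \<and> m \<notin> ell_infty \<and> NBB \<Psi>
        \<longrightarrow> \<not> multiplier_well_defined m \<Phi> \<Psi> \<and> \<not> multiplier_well_defined m \<Psi> \<Phi>)
    \<comment> \<open>(d2)\<close>
    \<and> (\<exists>(\<Phi> :: nat \<Rightarrow> 'a) \<Psi> m. admissible \<Phi> \<Psi> m \<and> \<not> NBB m \<and> m \<notin> ell_infty \<and> \<not> NBB \<Psi> \<and> \<not> NBA \<Psi> \<and> \<not> bessel \<Psi>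
        \<and> multiplier_invertible m \<Phi> \<Psi>)
    \<and> (\<exists>(\<Phi> :: nat \<Rightarrow> 'a) \<Psi> m. admissible \<Phi> \<Psi> m \<and> \<not> NBB m \<and> m \<notin> ell_infty \<and> \<not> NBB \<Psi> \<and> \<not> NBA \<Psi> \<and> \<not> bessel \<Psi>
        \<and> multiplier_well_defined m \<Phi> \<Psi> \<and> \<not> multiplier_invertible m \<Phi> \<Psi>)
    \<and> (\<exists>(\<Phi> :: nat \<Rightarrow> 'a) \<Psi> m. admissible \<Phi> \<Psi> m \<and> \<not> NBB m \<and> m \<notin> ell_infty \<and> \<not> NBB \<Psi> \<and> \<not> NBA \<Psi> \<and> \<not> bessel \<Psi>
        \<and> \<not> multiplier_well_defined m \<Phi> \<Psi>)
    \<and> (\<exists>(\<Phi> :: nat \<Rightarrow> 'a) \<Psi> m. admissible \<Phi> \<Psi> m \<and> \<not> NBB m \<and> m \<notin> ell_infty \<and> \<not> NBB \<Psi> \<and> \<not> NBA \<Psi> \<and> \<not> bessel \<Psi>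
        \<and> multiplier_invertible m \<Psi> \<Phi>)
    \<and> (\<exists>(\<Phi> :: nat \<Rightarrow> 'a) \<Psi> m. admissible \<Phi> \<Psi> m \<and> \<not> NBB m \<and> m \<notin> ell_infty \<and> \<not> NBB \<Psi> \<and> \<not> NBA \<Psi> \<and> \<not> bessel \<Psi>
        \<and> multiplier_well_defined m \<Psi> \<Phi> \<and> \<not> multiplier_invertible m \<Psi> \<Phi>)
    \<and> (\<exists>(\<Phi> :: nat \<Rightarrow> 'a) \<Psi> m. admissible \<Phi> \<Psi> m \<and> \<not> NBB m \<and> m \<notin> ell_infty \<and> \<not> NBB \<Psi> \<and> \<not> NBA \<Psi> \<and> \<not> bessel \<Psi>
        \<and> \<not> multiplier_well_defined m \<Psi> \<Phi>)
    \<comment> \<open>(d3)\<close>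
    \<and> (\<exists>(\<Phi> :: nat \<Rightarrow> 'a) \<Psi> m. admissible \<Phi> \<Psi> m \<and> \<not> NBB m \<and> m \<notin> ell_infty \<and> \<not> NBB \<Psi> \<and> NBA \<Psi>
        \<and> multiplier_well_defined m \<Phi> \<Psi>)
    \<and> (\<exists>(\<Phi> :: nat \<Rightarrow> 'a) \<Psi> m. admissible \<Phi> \<Psi> m \<and> \<not> NBB m \<and> m \<notin> ell_infty \<and> \<not> NBB \<Psi> \<and> NBA \<Psi>
        \<and> \<not> multiplier_well_defined m \<Phi> \<Psi>)
    \<and> (\<exists>(\<Phi> :: nat \<Rightarrow> 'a) \<Psi> m. admissible \<Phi> \<Psi> m \<and> \<not> NBB m \<and> m \<notin> ell_infty \<and> \<not> NBB \<Psi> \<and> NBA \<Psi>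
        \<and> multiplier_well_defined m \<Psi> \<Phi>)
    \<and> (\<exists>(\<Phi> :: nat \<Rightarrow> 'a) \<Psi> m. admissible \<Phi> \<Psi> m \<and> \<not> NBB m \<and> m \<notin> ell_infty \<and> \<not> NBB \<Psi> \<and> NBA \<Psi>
        \<and> \<not> multiplier_well_defined m \<Psi> \<Phi>)
    \<and> (\<forall>(\<Phi> :: nat \<Rightarrow> 'a) \<Psi> m. admissible \<Phi> \<Psi> m \<and> \<not> NBB m \<and> m \<notin> ell_infty \<and> \<not> NBB \<Psi> \<and> NBA \<Psi>
        \<longrightarrow> \<not> multiplier_invertible m \<Phi> \<Psi> \<and> \<not> multiplier_invertible m \<Psi> \<Phi>)"
proof -
  obtain e :: "nat \<Rightarrow> 'a" where "orthonormal_basis e"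
    using ex_orthonormal_basis[OF assms] .
  then interpret orthonormal_basis e .
  show ?thesis
    apply (intro conjI)
    subgoal using NBB_symbol_non_bessel SN_imp by blast
    subgoal using SN_bessel by blast
    \<comment> \<open>For the constant sequence \<open>e 0\<close> in (b1), weights 1/(n + 1)
      produce a Bessel product. Below, weights decaying at odd indices alone leave the even copies
      of \<open>e 0\<close> intact, and the product is not Bessel.\<close>
    subgoal by (rule ex3I[of _ e "repeated 0 0" "alternating_power (- 1) (- 1)"])
        (simp add: example_simps)
    subgoal by (rule ex3I[of _ e "repeated 0 0" "alternating_power 0 (- 1)"])
        (simp add: example_simps)
    subgoal by (rule ex3I[of _ e "repeated 0 0" "alternating_power (- 1) (- 1)"])
        (simp add: example_simps)
    subgoal by (rule ex3I[of _ e "repeated 0 0" "alternating_power 0 (- 1)"])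
        (simp add: example_simps)
    subgoal using non_NBB_symbol_NBA by blast
    \<comment> \<open>In (b2) norms grow at even and decay at odd indices. The symbol either cancels
      the growth, giving \<open>diag 0 (- 2)\<close>, or leaves it, giving
      \<open>diag 1 (- 2)\<close>.\<close>
    subgoal by (rule ex3I[of _ e "diag 1 (- 1)" "alternating_power (- 1) (- 1)"])
        (simp add: example_simps)
    subgoal by (rule ex3I[of _ e "diag 1 (- 1)" "alternating_power 0 (- 1)"])
        (simp add: example_simps)
    subgoal by (rule ex3I[of _ e "diag 1 (- 1)" "alternating_power (- 1) (- 1)"])
        (simp add: example_simps)
    subgoal by (rule ex3I[of _ e "diag 1 (- 1)" "alternating_power 0 (- 1)"])
        (simp add: example_simps)
    subgoal using bounded_symbol_non_NBB by blast
    \<comment> \<open>The three symbols for (b3) turn \<open>diag 1 1\<close> into the basis itself,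
      the Bessel but not Riesz sequence \<open>diag (- 1) (- 1)\<close>, and the unbounded
      \<open>diag 1 0\<close>.\<close>
    subgoal by (rule ex3I[of _ e "diag 1 1" "alternating_power (- 1) (- 1)"])
        (simp add: example_simps)
    subgoal by (rule ex3I[of _ e "diag 1 1" "alternating_power (- 2) (- 2)"])
        (simp add: example_simps)
    subgoal by (rule ex3I[of _ e "diag 1 1" "alternating_power 0 (- 1)"])
        (simp add: example_simps)
    subgoal using bounded_symbol_bessel non_NBB_symbol_NBA bessel_imp_NBA by blast
    subgoal using NBB_symbol_non_bessel unbounded_symbol_NBB by blast
    \<comment> \<open>For (c2) the products are the basis itself, \<open>diag 0 (- 1)\<close> and
      \<open>diag 1 1\<close>.\<close>
    subgoal by (rule ex3I[of _ e "diag (- 1) (- 1)" "alternating_power 1 1"])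
        (simp add: example_simps not_frame_diag)
    subgoal by (rule ex3I[of _ e "diag (- 1) (- 1)" "alternating_power 1 0"])
        (simp add: example_simps not_frame_diag)
    subgoal by (rule ex3I[of _ e "diag (- 1) (- 1)" "alternating_power 2 2"])
        (simp add: example_simps not_frame_diag)
    \<comment> \<open>In (c3) the symbol acts on the decaying odd copies: exponent 1 restores the
      Bessel sequence \<open>doubled 0 0\<close>, exponent 2 overshoots to
      \<open>doubled 0 1\<close>.\<close>
    subgoal by (rule ex3I[of _ e "doubled 0 (- 1)" "alternating_power 0 1"])
        (simp add: example_simps frame_doubled)
    subgoal by (rule ex3I[of _ e "doubled 0 (- 1)" "alternating_power 0 2"])
        (simp add: example_simps frame_doubled)
    subgoal by (rule ex3I[of _ e "doubled 0 (- 1)" "alternating_power 0 1"])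
        (simp add: example_simps frame_doubled)
    subgoal by (rule ex3I[of _ e "doubled 0 (- 1)" "alternating_power 0 2"])
        (simp add: example_simps frame_doubled)
    subgoal using unbounded_symbol_frame by blast
    subgoal using unbounded_symbol_NBB by blast
    \<comment> \<open>For (d2) the symbol counters growth and decay at once; the products are the
      basis itself, \<open>diag (- 1) 0\<close> and \<open>diag 0 1\<close>.\<close>
    subgoal by (rule ex3I[of _ e "diag 1 (- 1)" "alternating_power (- 1) 1"])
        (simp add: example_simps)
    subgoal by (rule ex3I[of _ e "diag 1 (- 1)" "alternating_power (- 2) 1"])
        (simp add: example_simps)
    subgoal by (rule ex3I[of _ e "diag 1 (- 1)" "alternating_power (- 1) 2"])
        (simp add: example_simps)
    subgoal by (rule ex3I[of _ e "diag 1 (- 1)" "alternating_power (- 1) 1"])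
        (simp add: example_simps)
    subgoal by (rule ex3I[of _ e "diag 1 (- 1)" "alternating_power (- 2) 1"])
        (simp add: example_simps)
    subgoal by (rule ex3I[of _ e "diag 1 (- 1)" "alternating_power (- 1) 2"])
        (simp add: example_simps)
    \<comment> \<open>For (d3) the products are the Bessel sequence \<open>diag (- 1) 0\<close> and
      the unbounded \<open>diag (- 1) 1\<close>.\<close>
    subgoal by (rule ex3I[of _ e "diag 0 (- 1)" "alternating_power (- 1) 1"])
        (simp add: example_simps)
    subgoal by (rule ex3I[of _ e "diag 0 (- 1)" "alternating_power (- 1) 2"])
        (simp add: example_simps)
    subgoal by (rule ex3I[of _ e "diag 0 (- 1)" "alternating_power (- 1) 1"])
        (simp add: example_simps)
    subgoal by (rule ex3I[of _ e "diag 0 (- 1)" "alternating_power (- 1) 2"])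
        (simp add: example_simps)
    subgoal using non_NBB_symbol_NBA by blast
    done
qed

end
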